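(* Let $\nu\ge1$, let $\omega\in\mathbb{R}^\nu$ be diophantine, let $f$ be a trigonometric polynomial on $\mathbb{T}^\nu$, and let $$H_\epsilon(p,q)=\omega\cdot p+\tfrac12\,p^2+\epsilon f(q),\qquad (p,q)\in\mathbb{R}^\nu\times\mathbb{T}^\nu,$$ be a real-valued Hamiltonian, where $p^2=p\cdot p$. Then there exists a canonical formal transformation $q=q'+\epsilon\cdots$, $p=p'+\epsilon\cdots$ which brings $H_\epsilon$ into Kolmogorov normal form, that is, the Hamiltonian expressed in the new variables (again denoted $(p,q)$) is $$\omega\cdot p+R(p,q,\epsilon),\qquad R(p,q,\epsilon)=O(p^2).$$
   Context: $\mathbb{T}^\nu=(\mathbb{R}/2\pi\mathbb{Z})^\nu$, and a trigonometric polynomial in $q$ is a finite linear combination of the functions $e^{\mathrm{i}k\cdot q}$, $k\in\mathbb{Z}^\nu$. A vector $\omega\in\mathbb{R}^\nu$ is diophantine if there are $\gamma>0$ and $\tau\geq 0$ with $|k\cdot\omega|\ge\gamma|k|^{-\tau}$ for all $k\in\mathbb{Z}^\nu\setminus\{0\}$. "Formal" means formal power series in $\epsilon$: one works with series $\sum_{s\ge0}\epsilon^sf_s(p,q)$ whose coefficients $f_s$ are trigonometric polynomials in $q$ with coefficients polynomial in $p$. The notation $q=q'+\epsilon\cdots$, $p=p'+\epsilon\cdots$ means that the transformation is the identity at order $\epsilon^0$. It is canonical if it preserves the symplectic form, $\sum_i dp_i\wedge dq_i=\sum_idp'_i\wedge dq'_i$, at every order in $\epsilon$. The notation $R=O(p^2)$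 means that each coefficient of $\epsilon^s$ in $R$ vanishes at $p=0$ together with its first derivatives in $p$, for every $q$.
   Formalization: The normal form is proved up to an additive formal series of real constants, E(ε)+ω·p+R; without such a constant the claim is false, e.g. for ν=1, f=1, where q cannot remain periodic under a canonical transformation. *)

theory Defs
  imports "HOL-Analysis.Analysis"
begin

type_synonym 'n phase = "(real ^ 'n) \<times> (real ^ 'n)"

definition real_vec :: "int ^ 'n \<Rightarrow> real ^ 'n" where
  "real_vec k = (\<chi> i. real_of_int (k $ i))"

definition diophantine :: "real ^ 'n::finite \<Rightarrow> bool" where
  "diophantine \<omega> \<longleftrightarrow>
     (\<exists>\<gamma>>0. \<exists>\<tau>\<ge>0. \<forall>k::int ^ 'n. k \<noteq> 0 \<longrightarrow>
        \<bar>real_vec k \<bullet> \<omega>\<bar> \<ge> \<gamma> * norm (real_vec k) powr (- \<tau>))"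

(* Functions on the torus are represented by their lifts to R^n; a trigonometric polynomial is
   automatically 2 pi periodic in every coordinate. Observables are real valued, so the complex
   Fourier coefficients below are constrained by the requirement that the sum be real. *)

definition trig_polynomial :: "(real ^ 'n::finite \<Rightarrow> real) \<Rightarrow> bool" where
  "trig_polynomial f \<longleftrightarrow>
     (\<exists>(K :: (int ^ 'n) set) (c :: int ^ 'n \<Rightarrow> complex). finite K \<and>
        (\<forall>q. complex_of_real (f q) =
           (\<Sum>k\<in>K. c k * exp (\<i> * complex_of_real (real_vec k \<bullet> q)))))"

definition poly_trig_polynomial :: "('n::finite phase \<Rightarrow> real) \<Rightarrow> bool" where
  "poly_trig_polynomial g \<longleftrightarrow>
     (\<exists>(K :: (int ^ 'n) set) (c :: int ^ 'n \<Rightarrow> real ^ 'n \<Rightarrow> complex).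
        finite K \<and> (\<forall>k\<in>K. polynomial_function (c k)) \<and>
        (\<forall>p q. complex_of_real (g (p, q)) =
           (\<Sum>k\<in>K. c k p * exp (\<i> * complex_of_real (real_vec k \<bullet> q)))))"

(* A formal series in epsilon is the sequence of its coefficients. A transformation
   (p, q) = Phi (p', q') is the sequence of phase-space valued coefficients; the coefficient of
   order 0 is the identity, and only the corrections are periodic in q'. *)

definition formal_transformation :: "(nat \<Rightarrow> 'n::finite phase \<Rightarrow> 'n phase) \<Rightarrow> bool" where
  "formal_transformation \<Phi> \<longleftrightarrow>
     \<Phi> 0 = id \<and>
     (\<forall>s\<ge>1. \<forall>i. poly_trig_polynomial (\<lambda>z. fst (\<Phi> s z) $ i) \<and>
                poly_trig_polynomial (\<lambda>z. snd (\<Phi> s z) $ i))"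

(* The two-form (sum over i of dp_i wedge dq_i) evaluated on two tangent vectors. *)

definition symplectic_form :: "'n::finite phase \<Rightarrow> 'n phase \<Rightarrow> real" where
  "symplectic_form u v = fst u \<bullet> snd v - fst v \<bullet> snd u"

(* The left-hand side is the coefficient of epsilon^s in the pull-back of the symplectic form. *)

definition canonical_transformation :: "(nat \<Rightarrow> 'n::finite phase \<Rightarrow> 'n phase) \<Rightarrow> bool" where
  "canonical_transformation \<Phi> \<longleftrightarrow>
     (\<forall>s z u v.
        (\<Sum>j\<le>s. symplectic_form (frechet_derivative (\<Phi> j) (at z) u)
                              (frechet_derivative (\<Phi> (s - j)) (at z) v))
        = (if s = 0 then symplectic_form u v else 0))"

definition hamiltonian ::
  "real ^ 'n::finite \<Rightarrow> (real ^ 'n \<Rightarrow> real) \<Rightarrow> real \<Rightarrow> 'n phase \<Rightarrow> real" where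
  "hamiltonian \<omega> f \<epsilon> = (\<lambda>(p, q). \<omega> \<bullet> p + (p \<bullet> p) / 2 + \<epsilon> * f q)"

(* Coefficients of the formal expansion of H_epsilon (Phi_epsilon z): the coefficient of
   epsilon^s is the Taylor coefficient at epsilon = 0 obtained after truncating Phi at order s.
   The truncation makes this a function of epsilon (no convergence of Phi is needed) and does
   not influence the coefficient. Meaningful when H is smooth in (epsilon, z). *)

definition formal_pullback ::
  "(real \<Rightarrow> 'n::finite phase \<Rightarrow> real) \<Rightarrow> (nat \<Rightarrow> 'n phase \<Rightarrow> 'n phase) \<Rightarrow>
     nat \<Rightarrow> 'n phase \<Rightarrow> real" where
  "formal_pullback H \<Phi> s z =
     (deriv ^^ s) (\<lambda>\<epsilon>. H \<epsilon> (\<Sum>j\<le>s. \<epsilon> ^ j *\<^sub>R \<Phi> j z)) 0 / fact s"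

definition vanishes_to_second_order :: "('n::finite phase \<Rightarrow> real) \<Rightarrow> bool" where
  "vanishes_to_second_order g \<longleftrightarrow>
     (\<forall>q. g (0, q) = 0 \<and> ((\<lambda>p. g (p, q)) has_derivative (\<lambda>_. 0)) (at 0))"

(* A Hamiltonian matters only up to an additive constant, here a formal series E in epsilon
   independent of (p, q). It cannot be dropped: with f = 1 in dimension 1, vanishing of the
   order-1 coefficient to second order at p = 0 forces, for the first corrections P and Q,
   P(0,q) = -1/\<omega> and dP/dp(0,q) = 1/\<omega>^2, whence dQ/dq(0,q) = -1/\<omega>^2 by
   canonicity, contradicting periodicity of Q. *)

definition kolmogorov_normal_form ::
  "real ^ 'n::finite \<Rightarrow> (nat \<Rightarrow> 'n phase \<Rightarrow> real) \<Rightarrow> bool" where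
  "kolmogorov_normal_form \<omega> K \<longleftrightarrow>
     (\<exists>(E :: nat \<Rightarrow> real) (R :: nat \<Rightarrow> 'n phase \<Rightarrow> real).
        (\<forall>s. poly_trig_polynomial (R s) \<and> vanishes_to_second_order (R s)) \<and>
        (\<forall>s p q. K s (p, q) = E s + (if s = 0 then \<omega> \<bullet> p else 0) + R s (p, q)))"

end

theory Submission
  imports Defs "HOL-Computational_Algebra.Formal_Power_Series"
begin

text \<open>
  The transformation is affine in the momenta and is read off from the Lindstedt series. Let
  \<open>D = \<omega> \<cdot> \<partial>\<close>, and let \<open>h\<close> solve \<open>D\<^sup>2 h = - \<epsilon> \<nabla>f (\<psi> + h)\<close> order by order; the right-hand
  side has zero average at every order because \<open>D\<^sup>2 h \<cdot> \<partial>\<^sub>i h\<close> has zero average for every \<open>h\<close> and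
  \<open>\<Sum>\<^sub>a \<partial>\<^sub>a f (\<psi> + h) \<partial>\<^sub>i (\<psi> + h)\<^sub>a\<close> is the derivative of \<open>f (\<psi> + h)\<close>. The torus \<open>q = \<psi> + h\<close>,
  \<open>p = D h\<close> is invariant, of constant energy and Lagrangian, so
  \<open>q = \<psi> + h\<close>, \<open>p = D h + (1 + \<partial>h)\<^sup>-\<^sup>T I\<close> is canonical. Since \<open>\<omega> + D h = (1 + \<partial>h) \<omega>\<close>,
  substituting it into the Hamiltonian, which is quadratic in \<open>p\<close>, leaves a constant, the linear
  term \<open>\<omega> \<cdot> I\<close> and a quadratic form in \<open>I\<close>.
\<close>

unbundle no vec_syntax and fps_syntax

subsection \<open>Algebras with a quasiperiodic derivation\<close>

definition fps_map :: "('a \<Rightarrow> 'b) \<Rightarrow> 'a fps \<Rightarrow> 'b fps" where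
  "fps_map f X = Abs_fps (\<lambda>n. f (X $ n))"

lemma fps_map_nth [simp]: "fps_map f X $ n = f (X $ n)"
  by (simp add: fps_map_def)

text \<open>Abstracts the trigonometric polynomials with partial derivatives \<open>pd i\<close>.
  The last three axioms carry the arithmetic of the frequencies: rigidity under a double flow
  derivative, solvability of the cohomological equation up to a constant, and exactness of partial
  derivatives, which makes their averages vanish.\<close>

locale quasiperiodic_algebra =
  fixes pd :: "'n::finite \<Rightarrow> 'a::{comm_ring_1, real_algebra_1} \<Rightarrow> 'a"
    and \<omega> :: "'n \<Rightarrow> real"
  assumes pd_linear: "linear (pd i)"
    and pd_mult: "pd i (x * y) = pd i x * y + x * pd i y"
    and pd_commute: "pd i (pd j x) = pd j (pd i x)"
    and flow_kernel: "(\<Sum>i\<in>UNIV. \<omega> i *\<^sub>R pd i (\<Sum>i\<in>UNIV. \<omega> i *\<^sub>R pd i x)) = 0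
                      \<Longrightarrow> (\<Sum>i\<in>UNIV. \<omega> i *\<^sub>R pd i x) = 0"
    and flow_decomposition: "\<exists>c u. x = of_real c + (\<Sum>i\<in>UNIV. \<omega> i *\<^sub>R pd i u)"
    and pd_exact: "\<exists>v. pd i u = (\<Sum>i\<in>UNIV. \<omega> i *\<^sub>R pd i v)"
begin

lemmas pd_add = linear_add [OF pd_linear]
  and pd_diff = linear_diff [OF pd_linear]
  and pd_minus = linear_neg [OF pd_linear]
  and pd_0 [simp] = linear_0 [OF pd_linear]
  and pd_sum = linear_sum [OF pd_linear]
  and pd_scaleR = linear_cmul [OF pd_linear]

lemma pd_1 [simp]: "pd i 1 = 0"
  using pd_mult [of i 1 1] by simp

lemma pd_of_real [simp]: "pd i (of_real c) = 0"
  by (simp add: of_real_def pd_scaleR)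

definition flow :: "'a \<Rightarrow> 'a" where
  "flow x = (\<Sum>i\<in>UNIV. \<omega> i *\<^sub>R pd i x)"

lemma flow_linear: "linear flow"
  unfolding flow_def
  by (intro linear_compose_sum ballI linear_compose_scale_right pd_linear)

lemmas flow_add = linear_add [OF flow_linear]
  and flow_diff = linear_diff [OF flow_linear]
  and flow_minus = linear_neg [OF flow_linear]
  and flow_0 [simp] = linear_0 [OF flow_linear]
  and flow_sum = linear_sum [OF flow_linear]
  and flow_scaleR = linear_cmul [OF flow_linear]

lemma flow_of_real [simp]: "flow (of_real c) = 0"
  by (simp add: flow_def)

lemma flow_pd: "flow (pd i x) = pd i (flow x)"
  by (simp add: flow_def pd_sum pd_scaleR pd_commute [of i])

lemma flow_eq_of_realD: "flow u = of_real c \<Longrightarrow> c = 0"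
  using flow_kernel [of u, folded flow_def] by simp

text \<open>Splitting \<open>x\<close> into a constant and \<open>flow u\<close>, the second flow
  derivative of \<open>u\<close> vanishes, hence so does the first by \<open>flow_kernel\<close>.
  This is ergodicity of the flow in algebraic form.\<close>

lemma flow_eq_0D:
  assumes "flow x = 0"
  shows "\<exists>c. x = of_real c"
proof -
  obtain c u where x: "x = of_real c + flow u"
    using flow_decomposition [of x] by (auto simp: flow_def)
  with assms have "flow (flow u) = 0"
    by (simp add: flow_add)
  then have "flow u = 0"
    using flow_kernel [of u] by (simp add: flow_def)
  with x show ?thesis by auto
qed

text \<open>The mean value over the torus, obtained without integration: the only constant that
  differs from \<open>x\<close> by a flow derivative.\<close>

definition avg :: "'a \<Rightarrow> real" where
  "avg x = (THE c. \<exists>u. x = of_real c + flow u)"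

lemma avg_eqI:
  assumes "x = of_real c + flow u"
  shows "avg x = c"
  unfolding avg_def
proof (rule the_equality)
  show "\<exists>u. x = of_real c + flow u" using assms by blast
next
  fix d assume "\<exists>v. x = of_real d + flow v"
  then obtain v where "x = of_real d + flow v" ..
  with assms have "flow (u - v) = of_real (d - c)"
    by (simp add: flow_diff algebra_simps)
  then show "d = c" using flow_eq_of_realD by fastforce
qed

lemma avg_decomposition: "\<exists>u. x = of_real (avg x) + flow u"
  using flow_decomposition [of x] avg_eqI by (auto simp: flow_def)

lemma avg_linear: "linear avg"
proof
  fix x y r
  obtain u v where uv: "x = of_real (avg x) + flow u" "y = of_real (avg y) + flow v"
    using avg_decomposition by metis
  then have "x + y = of_real (avg x + avg y) + flow (u + v)"
    by (metis (no_types, lifting) add.assoc add.left_commute flow_add of_real_add)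
  then show "avg (x + y) = avg x + avg y" by (rule avg_eqI)
  have "r *\<^sub>R x = r *\<^sub>R (of_real (avg x) + flow u)" using uv by metis
  also have "\<dots> = of_real (r * avg x) + flow (r *\<^sub>R u)"
    by (simp add: scaleR_right_distrib flow_scaleR) (simp add: scaleR_conv_of_real)
  finally show "avg (r *\<^sub>R x) = r *\<^sub>R avg x" by (auto intro: avg_eqI)
qed

lemmas avg_add = linear_add [OF avg_linear]
  and avg_diff = linear_diff [OF avg_linear]
  and avg_0 [simp] = linear_0 [OF avg_linear]
  and avg_sum = linear_sum [OF avg_linear]
  and avg_scaleR = linear_cmul [OF avg_linear]

lemma avg_of_real [simp]: "avg (of_real c) = c"
  by (rule avg_eqI [of _ _ 0]) simp

lemma avg_flow [simp]: "avg (flow u) = 0"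
  by (rule avg_eqI [of _ _ u]) simp

lemma avg_pd [simp]: "avg (pd i u) = 0"
proof -
  obtain v where "pd i u = flow v" using pd_exact by (auto simp: flow_def)
  then show ?thesis by simp
qed

lemma avg_of_real_mult [simp]: "avg (of_real c * x) = c * avg x"
  using avg_scaleR [of c x] by (simp add: scaleR_conv_of_real)

text \<open>An antiderivative along the flow, determined up to a constant; later arguments use only
  the equation it solves.\<close>

definition flow_inverse :: "'a \<Rightarrow> 'a" where
  "flow_inverse x = (SOME u. x = of_real (avg x) + flow u)"

lemma flow_inverse: "flow (flow_inverse x) = x - of_real (avg x)"
  using someI_ex [OF avg_decomposition, of x] unfolding flow_inverse_def
  by (simp add: algebra_simps)

subsection \<open>Formal series over the algebra\<close>

abbreviation cst :: "real \<Rightarrow> 'a fps" where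
  "cst r \<equiv> fps_const (of_real r)"

abbreviation PD :: "'n \<Rightarrow> 'a fps \<Rightarrow> 'a fps" where
  "PD i \<equiv> fps_map (pd i)"

abbreviation Flow :: "'a fps \<Rightarrow> 'a fps" where
  "Flow \<equiv> fps_map flow"

abbreviation Avg :: "'a fps \<Rightarrow> real fps" where
  "Avg \<equiv> fps_map avg"

abbreviation embed :: "real fps \<Rightarrow> 'a fps" where
  "embed \<equiv> fps_map of_real"

lemma PD_add: "PD i (X + Y) = PD i X + PD i Y"
  and PD_diff: "PD i (X - Y) = PD i X - PD i Y"
  and PD_minus: "PD i (- X) = - PD i X"
  and PD_0 [simp]: "PD i 0 = 0"
  and PD_1 [simp]: "PD i 1 = 0"
  and PD_cst [simp]: "PD i (cst r) = 0"
  and PD_X [simp]: "PD i fps_X = 0"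
  by (simp_all add: fps_eq_iff pd_add pd_diff pd_minus fps_X_def fps_one_nth)

lemma PD_sum: "PD i (\<Sum>j\<in>S. X j) = (\<Sum>j\<in>S. PD i (X j))"
  by (simp add: fps_eq_iff fps_sum_nth pd_sum)

lemma PD_mult: "PD i (X * Y) = PD i X * Y + X * PD i Y"
  by (simp add: fps_eq_iff fps_mult_nth pd_sum pd_mult sum.distrib)

lemma PD_commute: "PD i (PD j X) = PD j (PD i X)"
  by (simp add: fps_eq_iff pd_commute)

lemma PD_fps_deriv: "PD i (fps_deriv X) = fps_deriv (PD i X)"
proof -
  have "pd i (of_nat k * x) = of_nat k * pd i x" for k x
    using pd_scaleR [of i "of_nat k" x] by (simp add: scaleR_conv_of_real)
  then show ?thesis by (simp add: fps_eq_iff del: of_nat_Suc of_nat_add)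
qed

lemma Flow_conv_PD: "Flow X = (\<Sum>i\<in>UNIV. cst (\<omega> i) * PD i X)"
  by (simp add: fps_eq_iff fps_sum_nth flow_def scaleR_conv_of_real)

lemma Flow_PD: "Flow (PD i X) = PD i (Flow X)"
  by (simp add: fps_eq_iff flow_pd)

lemma Flow_add: "Flow (X + Y) = Flow X + Flow Y"
  and Flow_diff: "Flow (X - Y) = Flow X - Flow Y"
  and Flow_cst [simp]: "Flow (cst r) = 0"
  and Flow_1 [simp]: "Flow 1 = 0"
  and Flow_0 [simp]: "Flow 0 = 0"
  and Flow_X [simp]: "Flow fps_X = 0"
  by (simp_all add: Flow_conv_PD PD_add PD_diff sum.distrib sum_subtractf algebra_simps)

lemma Flow_mult: "Flow (X * Y) = Flow X * Y + X * Flow Y"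
  by (simp add: Flow_conv_PD PD_mult sum.distrib sum_distrib_left sum_distrib_right algebra_simps)

lemma Flow_sum: "Flow (\<Sum>j\<in>S. X j) = (\<Sum>j\<in>S. Flow (X j))"
  by (simp add: fps_eq_iff fps_sum_nth flow_sum)

lemma Flow_eq_0D:
  assumes "Flow X = 0"
  shows "X = embed (Avg X)"
proof (rule fps_ext)
  fix n
  have "flow (X $ n) = 0" using assms by (simp add: fps_eq_iff)
  then obtain c where "X $ n = of_real c" using flow_eq_0D by blast
  then show "X $ n = embed (Avg X) $ n" by simp
qed

lemma Avg_add: "Avg (X + Y) = Avg X + Avg Y"
  and Avg_diff: "Avg (X - Y) = Avg X - Avg Y"
  and Avg_Flow [simp]: "Avg (Flow X) = 0"
  and Avg_PD [simp]: "Avg (PD i X) = 0"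
  by (simp_all add: fps_eq_iff avg_add avg_diff)

lemma Avg_sum: "Avg (\<Sum>j\<in>S. X j) = (\<Sum>j\<in>S. Avg (X j))"
  by (simp add: fps_eq_iff fps_sum_nth avg_sum)

lemma Avg_embed_mult: "Avg (embed Z * X) = Z * Avg X"
  by (simp add: fps_eq_iff fps_mult_nth avg_sum)

lemma Avg_X_mult: "Avg (fps_X * X) = fps_X * Avg X"
  by (simp add: fps_eq_iff)

subsection \<open>Formal composition\<close>

text \<open>The coefficients of the Taylor expansion of \<open>g (\<psi> + h \<psi>)\<close>, computed
  from \<open>d/d\<epsilon> (g \<circ> q) = \<Sum>\<^sub>a (\<partial>\<^sub>a g \<circ> q) dq\<^sub>a/d\<epsilon>\<close>.\<close>

fun formal_compose_coeff :: "('n \<Rightarrow> 'a fps) \<Rightarrow> nat \<Rightarrow> 'a \<Rightarrow> 'a" where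
  "formal_compose_coeff h 0 g = g"
| "formal_compose_coeff h (Suc n) g = (1 / real (Suc n)) *\<^sub>R
     (\<Sum>a\<in>UNIV. \<Sum>j\<le>n. formal_compose_coeff h (n - j) (pd a g) * fps_deriv (h a) $ j)"

definition formal_compose :: "('n \<Rightarrow> 'a fps) \<Rightarrow> 'a \<Rightarrow> 'a fps" where
  "formal_compose h g = Abs_fps (\<lambda>n. formal_compose_coeff h n g)"

lemma formal_compose_nth: "formal_compose h g $ n = formal_compose_coeff h n g"
  by (simp add: formal_compose_def)

lemma formal_compose_nth_0 [simp]: "formal_compose h g $ 0 = g"
  by (simp add: formal_compose_nth)

text \<open>Causality: the shift of index in \<open>fps_deriv\<close> is offset by the drop from
  \<open>Suc n\<close> to \<open>n\<close> in the recursion. This makes the Lindstedt recursion well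
  founded.\<close>

lemma formal_compose_coeff_cong:
  assumes "\<And>a j. j \<le> n \<Longrightarrow> h a $ j = h' a $ j"
  shows "formal_compose_coeff h n g = formal_compose_coeff h' n g"
  using assms
proof (induction n arbitrary: g rule: less_induct)
  case (less n)
  show ?case
  proof (cases n)
    case (Suc m)
    have "formal_compose_coeff h (m - j) g = formal_compose_coeff h' (m - j) g" for j g
      using Suc by (intro less.IH less.prems) auto
    moreover have "fps_deriv (h a) $ j = fps_deriv (h' a) $ j" if "j \<le> m" for a j
      using less.prems [of "Suc j" a] that Suc by simp
    ultimately show ?thesis
      unfolding Suc formal_compose_coeff.simps
      by (intro arg_cong [where f = "(*\<^sub>R) _"] sum.cong refl) simp
  qed simp
qed

lemma of_nat_mult_scaleR: "of_nat (Suc n) * ((1 / real (Suc n)) *\<^sub>R x) = (x :: 'a)"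
proof -
  have "of_nat (Suc n) * y = real (Suc n) *\<^sub>R y" for y :: 'a
    by (simp only: scaleR_conv_of_real of_real_of_nat_eq)
  then show ?thesis by (simp del: of_nat_Suc)
qed

lemma fps_deriv_formal_compose:
  "fps_deriv (formal_compose h g) = (\<Sum>a\<in>UNIV. formal_compose h (pd a g) * fps_deriv (h a))"
proof (rule fps_ext)
  fix n
  have "fps_deriv (formal_compose h g) $ n = of_nat (Suc n) * formal_compose_coeff h (Suc n) g"
    by (simp add: formal_compose_nth del: formal_compose_coeff.simps)
  also have "\<dots> = (\<Sum>a\<in>UNIV. \<Sum>j\<le>n. formal_compose_coeff h (n - j) (pd a g) * fps_deriv (h a) $ j)"
    unfolding formal_compose_coeff.simps by (rule of_nat_mult_scaleR)
  also have "\<dots> = (\<Sum>a\<in>UNIV. fps_deriv (h a) * formal_compose h (pd a g)) $ n"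
    unfolding fps_sum_nth fps_mult_nth
    by (intro sum.cong) (simp_all add: formal_compose_nth mult.commute atLeast0AtMost)
  finally show "fps_deriv (formal_compose h g) $ n = (\<Sum>a\<in>UNIV. formal_compose h (pd a g) * fps_deriv (h a)) $ n"
    by (simp add: mult.commute)
qed

text \<open>The linear system couples all \<open>g\<close> through their derivatives, so the
  induction on the order is uniform in \<open>g\<close>; each coefficient is determined by strictly
  lower ones.\<close>

lemma formal_compose_ode_unique:
  fixes Y :: "'a \<Rightarrow> 'a fps"
  assumes deriv: "\<And>g. fps_deriv (Y g) = (\<Sum>a\<in>UNIV. Y (pd a g) * fps_deriv (h a))"
    and zero: "\<And>g. Y g $ 0 = 0"
  shows "Y g = 0"
proof -
  have "Y g $ n = 0" for n
  proof (induction n arbitrary: g rule: less_induct)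
    case (less n)
    show ?case
    proof (cases n)
      case (Suc m)
      have "of_nat (Suc m) * Y g $ Suc m = fps_deriv (Y g) $ m" by simp
      also have "\<dots> = 0"
        using less.IH Suc unfolding deriv by (simp add: fps_sum_nth fps_mult_nth)
      finally have "(1 / real (Suc m)) *\<^sub>R (of_nat (Suc m) * Y g $ Suc m) = 0" by simp
      then have "of_nat (Suc m) * ((1 / real (Suc m)) *\<^sub>R Y g $ Suc m) = 0"
        by (simp del: of_nat_Suc)
      then show ?thesis unfolding of_nat_mult_scaleR Suc .
    qed (simp add: zero)
  qed
  then show ?thesis by (simp add: fps_eq_iff)
qed

text \<open>The matrix of derivatives of the map \<psi> + h. The identity is added by hand because
  the coordinates of \<psi> are not periodic and have no counterpart in the algebra.\<close>

definition jacobian :: "('n \<Rightarrow> 'a fps) \<Rightarrow> 'n \<Rightarrow> 'n \<Rightarrow> 'a fps" where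
  "jacobian h a i = (if a = i then 1 else 0) + PD i (h a)"

lemma jacobian_nth:
  "jacobian h a i $ n = (if a = i then if n = 0 then 1 else 0 else 0) + pd i (h a $ n)"
  by (simp add: jacobian_def fps_one_nth)

lemma PD_jacobian: "PD k (jacobian h a i) = PD k (PD i (h a))"
  by (simp add: jacobian_def PD_add)

lemma fps_deriv_jacobian: "fps_deriv (jacobian h a i) = PD i (fps_deriv (h a))"
  by (simp add: jacobian_def PD_fps_deriv)

lemma sum_jacobian: "(\<Sum>a\<in>UNIV. X a * jacobian h a i) = X i + (\<Sum>a\<in>UNIV. X a * PD i (h a))"
  by (simp add: jacobian_def distrib_left sum.distrib mult_delta_right)

lemma sum_jacobian': "(\<Sum>i\<in>UNIV. X i * jacobian h a i) = X a + (\<Sum>i\<in>UNIV. X i * PD i (h a))"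
  by (simp add: jacobian_def distrib_left sum.distrib mult_delta_right)

text \<open>The defect \<open>Y\<close> of the chain rule solves the homogeneous system of
  \<open>formal_compose_ode_unique\<close>, since partial derivatives commute, and it vanishes at
  order zero because \<open>h\<close> does.\<close>

lemma PD_formal_compose:
  assumes h0: "\<And>a. h a $ 0 = 0"
  shows "PD i (formal_compose h g) = (\<Sum>a\<in>UNIV. formal_compose h (pd a g) * jacobian h a i)"
proof -
  define Y where
    "Y g = PD i (formal_compose h g) - (\<Sum>a\<in>UNIV. formal_compose h (pd a g) * jacobian h a i)" for g
  have "fps_deriv (Y g) = (\<Sum>a\<in>UNIV. Y (pd a g) * fps_deriv (h a))" for g
  proof -
    have "fps_deriv (Y g) =
        PD i (\<Sum>a\<in>UNIV. formal_compose h (pd a g) * fps_deriv (h a))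
        - (\<Sum>a\<in>UNIV. (\<Sum>b\<in>UNIV. formal_compose h (pd b (pd a g)) * fps_deriv (h b)) * jacobian h a i
             + formal_compose h (pd a g) * PD i (fps_deriv (h a)))"
      by (simp add: Y_def fps_deriv_sum fps_deriv_formal_compose fps_deriv_jacobian
          flip: PD_fps_deriv) (simp add: algebra_simps)
    also have "\<dots> = (\<Sum>a\<in>UNIV. PD i (formal_compose h (pd a g)) * fps_deriv (h a))
        - (\<Sum>a\<in>UNIV. \<Sum>b\<in>UNIV. formal_compose h (pd b (pd a g)) * fps_deriv (h b) * jacobian h a i)"
      by (simp add: PD_sum PD_mult sum.distrib sum_distrib_right)
    also have "(\<Sum>a\<in>UNIV. \<Sum>b\<in>UNIV. formal_compose h (pd b (pd a g)) * fps_deriv (h b) * jacobian h a i)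
        = (\<Sum>b\<in>UNIV. \<Sum>a\<in>UNIV. formal_compose h (pd a (pd b g)) * jacobian h a i * fps_deriv (h b))"
      by (subst sum.swap) (simp add: pd_commute mult_ac)
    finally show ?thesis
      by (simp add: Y_def sum_subtractf left_diff_distrib sum_distrib_right)
  qed
  moreover have "Y g $ 0 = 0" for g
  proof -
    have "(\<Sum>a\<in>UNIV. pd a g * jacobian h a i $ 0) = pd i g"
      by (simp add: jacobian_nth h0 mult_delta_right)
    then show ?thesis by (simp add: Y_def fps_sum_nth)
  qed
  ultimately have "Y g = 0" by (rule formal_compose_ode_unique)
  then show ?thesis by (simp add: Y_def)
qed

text \<open>The chain rule contracted with \<omega>; the bracket is component \<open>a\<close> of (1
  + \<partial>h) \<omega>.\<close>

lemma Flow_formal_compose: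
  assumes "\<And>a. h a $ 0 = 0"
  shows "Flow (formal_compose h g) = (\<Sum>a\<in>UNIV. formal_compose h (pd a g) * (cst (\<omega> a) + Flow (h a)))"
proof -
  have "Flow (formal_compose h g)
      = (\<Sum>a\<in>UNIV. formal_compose h (pd a g) * (\<Sum>i\<in>UNIV. cst (\<omega> i) * jacobian h a i))"
    by (subst Flow_conv_PD, simp add: PD_formal_compose assms sum_distrib_left, subst sum.swap)
       (simp add: mult_ac)
  then show ?thesis by (simp add: sum_jacobian' flip: Flow_conv_PD)
qed

end

text \<open>Well-founded recursion on the order; it produces both the Lindstedt series and the
  inverse Jacobian coefficient by coefficient.\<close>

lemma causal_recursion:
  fixes F :: "(nat \<Rightarrow> 'b) \<Rightarrow> nat \<Rightarrow> 'b"
  assumes "\<And>x y n. (\<And>j. j < n \<Longrightarrow> x j = y j) \<Longrightarrow> F x n = F y n"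
  shows "\<exists>x. \<forall>n. x n = F x n"
proof -
  have "adm_wf less_than F"
    unfolding adm_wf_def by (intro allI impI assms) simp
  then have "wfrec less_than F = F (wfrec less_than F)"
    by (intro wfrec_fixpoint wf_less_than)
  from fun_cong [OF this] show ?thesis by blast
qed

context quasiperiodic_algebra
begin

subsection \<open>The Lindstedt series\<close>

text \<open>Subtracting the average makes the equation solvable at every order; only afterwards is
  this average shown to be zero. The factor \<open>fps_X\<close> shifts the order, so coefficient
  \<open>Suc m\<close> of \<open>h\<close> needs the composition only at order
  \<open>m\<close>.\<close>

lemma lindstedt_series_exists:
  "\<exists>h. (\<forall>a. h a $ 0 = 0) \<and>
     (\<forall>a. Flow (Flow (h a)) =
        - (fps_X * (formal_compose h (pd a f) - embed (Avg (formal_compose h (pd a f))))))"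
proof -
  define F where "F x n = (\<lambda>a. case n of 0 \<Rightarrow> 0
    | Suc m \<Rightarrow> - flow_inverse (flow_inverse
        (formal_compose_coeff (\<lambda>b. Abs_fps (\<lambda>j. x j b)) m (pd a f))))" for x :: "nat \<Rightarrow> 'n \<Rightarrow> 'a" and n
  have "\<exists>x. \<forall>n. x n = F x n"
  proof (rule causal_recursion)
    fix x y :: "nat \<Rightarrow> 'n \<Rightarrow> 'a" and n
    assume "\<And>j. j < n \<Longrightarrow> x j = y j"
    then show "F x n = F y n"
      by (auto simp: F_def fun_eq_iff split: nat.split
          intro!: arg_cong [where f = flow_inverse] formal_compose_coeff_cong)
  qed
  then obtain x where x: "\<And>n. x n = F x n" by blast
  define h where "h = (\<lambda>b. Abs_fps (\<lambda>j. x j b))"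
  have h_Suc: "h a $ Suc n = - flow_inverse (flow_inverse (formal_compose h (pd a f) $ n))" for a n
    using fun_cong [OF x, of "Suc n" a] by (simp add: h_def F_def formal_compose_nth)
  show ?thesis
  proof (intro exI conjI allI)
    show h0: "h a $ 0 = 0" for a
      using fun_cong [OF x, of 0 a] by (simp add: h_def F_def)
    show "Flow (Flow (h a)) =
        - (fps_X * (formal_compose h (pd a f) - embed (Avg (formal_compose h (pd a f)))))" for a
    proof (rule fps_ext)
      fix n
      \<comment> \<open>The inner antiderivative may have nonzero average, but the constant lost in
        the outer inversion is annihilated by the remaining \<open>flow\<close>.\<close>
      show "Flow (Flow (h a)) $ n =
          - (fps_X * (formal_compose h (pd a f) - embed (Avg (formal_compose h (pd a f))))) $ n"
        by (cases n) (simp_all add: h0 h_Suc flow_minus flow_diff flow_inverse)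
    qed
  qed
qed

text \<open>The Jacobian is the identity at order zero, so the equation for its inverse can be
  solved order by order.\<close>

lemma jacobian_left_inverse_exists:
  assumes h0: "\<And>a. h a $ 0 = 0"
  shows "\<exists>M. (\<forall>i j. (\<Sum>a\<in>UNIV. M i a * jacobian h a j) = (if i = j then 1 else 0)) \<and>
    (\<forall>i a. M i a $ 0 = (if i = a then 1 else 0))"
proof -
  \<comment> \<open>Coefficient \<open>n\<close> of M (1 + \<partial>h) = 1, solved for that of
    \<open>M\<close>; the term \<open>k = n\<close> drops out because \<open>h\<close> starts at
    order one.\<close>
  define F where "F x n = (\<lambda>i j. (if i = j then if n = 0 then 1 else 0 else 0)
      - (\<Sum>a\<in>UNIV. \<Sum>k<n. x k i a * PD j (h a) $ (n - k)))" for x :: "nat \<Rightarrow> 'n \<Rightarrow> 'n \<Rightarrow> 'a" and n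
  have "\<exists>x. \<forall>n. x n = F x n"
    by (rule causal_recursion) (simp add: F_def)
  then obtain x where x: "\<And>n. x n = F x n" by blast
  define M where "M i a = Abs_fps (\<lambda>k. x k i a)" for i a
  have M_nth: "M i j $ n = (if i = j then if n = 0 then 1 else 0 else 0)
      - (\<Sum>a\<in>UNIV. \<Sum>k<n. M i a $ k * PD j (h a) $ (n - k))" for i j n
    using fun_cong [OF fun_cong [OF x], of n i j] by (simp add: M_def F_def)
  show ?thesis
  proof (intro exI conjI allI)
    show "M i a $ 0 = (if i = a then 1 else 0)" for i a
      by (subst M_nth) simp
    show "(\<Sum>a\<in>UNIV. M i a * jacobian h a j) = (if i = j then 1 else 0)" for i j
    proof (rule fps_ext)
      fix n :: nat
      have "{0..n} = insert n {..<n}" by auto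
      then have "(\<Sum>a\<in>UNIV. M i a * jacobian h a j) $ n
          = M i j $ n + (\<Sum>a\<in>UNIV. \<Sum>k<n. M i a $ k * PD j (h a) $ (n - k))"
        unfolding sum_jacobian by (simp add: fps_sum_nth fps_mult_nth h0)
      also have "\<dots> = (if i = j then 1 else 0) $ n"
        by (subst M_nth) (simp add: fps_one_nth)
      finally show "(\<Sum>a\<in>UNIV. M i a * jacobian h a j) $ n = (if i = j then 1 else 0) $ n" .
    qed
  qed
qed

text \<open>Integration by parts along the flow turns the product into - U \<partial>U with U the
  flow derivative of \<open>X\<close>, and U \<partial>U is half the derivative of a square.\<close>

lemma Avg_Flow_Flow_mult_PD: "Avg (Flow (Flow X) * PD i X) = 0"
proof -
  define U where "U = Flow X"
  have "Flow (U * PD i X) = Flow U * PD i X + U * PD i U"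
    by (simp add: Flow_mult Flow_PD U_def)
  then have "Avg (Flow U * PD i X) + Avg (U * PD i U) = 0"
    by (metis Avg_Flow Avg_add)
  moreover have "PD i (U * U) = U * PD i U + U * PD i U"
    by (simp add: PD_mult mult.commute)
  then have "Avg (U * PD i U) + Avg (U * PD i U) = 0"
    by (metis Avg_PD Avg_add)
  then have "Avg (U * PD i U) = 0"
    by (simp add: fps_eq_iff)
  ultimately show ?thesis by (simp add: U_def)
qed

section \<open>Zero average, energy conservation and the Lagrangian property of the Lindstedt
  torus\<close>

context
  fixes h :: "'n \<Rightarrow> 'a fps" and f :: 'a
  assumes h0: "\<And>a. h a $ 0 = 0"
    and lindstedt: "\<And>a. Flow (Flow (h a)) =
           - (fps_X * (formal_compose h (pd a f) - embed (Avg (formal_compose h (pd a f)))))"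
begin

text \<open>The compatibility condition. Multiplying the equation for \<open>h a\<close> by
  \<open>PD i (h a)\<close> and averaging shows that the force times \<open>PD i (h a)\<close> has
  zero average; by the chain rule what remains of the average of
  \<open>PD i (formal_compose h f)\<close> is that of the force itself.\<close>

lemma Avg_formal_compose_pd: "Avg (formal_compose h (pd i f)) = 0"
proof -
  define G where "G a = formal_compose h (pd a f)" for a
  have "fps_X * Avg ((G a - embed (Avg (G a))) * PD i (h a)) = 0" for a
  proof -
    have "fps_X * ((G a - embed (Avg (G a))) * PD i (h a)) = - (Flow (Flow (h a)) * PD i (h a))"
      by (simp add: lindstedt G_def mult.assoc)
    then have "fps_X * Avg ((G a - embed (Avg (G a))) * PD i (h a))
        = Avg (- (Flow (Flow (h a)) * PD i (h a)))"
      by (metis Avg_X_mult)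
    also have "\<dots> = - Avg (Flow (Flow (h a)) * PD i (h a))"
      by (simp add: fps_eq_iff linear_neg [OF avg_linear])
    finally show ?thesis by (simp add: Avg_Flow_Flow_mult_PD)
  qed
  \<comment> \<open>The averages are real power series, an integral domain, so \<open>fps_X\<close>
    cancels.\<close>
  then have "Avg ((G a - embed (Avg (G a))) * PD i (h a)) = 0" for a
    by simp
  then have "Avg (G a * PD i (h a)) = 0" for a
    by (simp add: left_diff_distrib Avg_diff Avg_embed_mult)
  moreover have "Avg (PD i (formal_compose h f)) = Avg (G i) + (\<Sum>a\<in>UNIV. Avg (G a * PD i (h a)))"
    by (simp add: PD_formal_compose h0 sum_jacobian Avg_add Avg_sum G_def)
  ultimately show ?thesis by (simp add: G_def)
qed

text \<open>With the averages gone, the corrected equation becomes the equation of motion for the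
  quasiperiodic orbit \<psi> + h.\<close>

lemma newton: "Flow (Flow (h a)) = - (fps_X * formal_compose h (pd a f))"
  using lindstedt Avg_formal_compose_pd by (simp add: fps_eq_iff)

text \<open>Conservation of energy: by the chain rule the flow derivative is the velocity \<omega> +
  D h paired with both sides of \<open>newton\<close>, hence zero, and flow-invariant series are
  constant.\<close>

lemma energy_constant:
  "\<exists>E. (\<Sum>a\<in>UNIV. cst (\<omega> a) * Flow (h a)) + cst (1 / 2) * (\<Sum>a\<in>UNIV. Flow (h a) * Flow (h a))
        + fps_X * formal_compose h f = embed E"
proof -
  define V where "V a = Flow (h a)" for a
  have half: "cst (1 / 2) * (2 * X) = X" for X
  proof -
    have "of_real (1 / 2) * 2 = (1 :: 'a)"
      by (metis of_real_mult of_real_numeral of_real_1 nonzero_eq_divide_eq zero_neq_numeral)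
    then have "of_real (1 / 2) * (2 * x) = x" for x :: 'a
      by (metis mult.assoc mult_1)
    then show ?thesis by (simp add: fps_eq_iff)
  qed
  have "Flow (V a * V a) = 2 * (V a * Flow (V a))" for a
    by (simp add: Flow_mult mult.commute)
  then have "Flow (cst (1 / 2) * (\<Sum>a\<in>UNIV. V a * V a)) = (\<Sum>a\<in>UNIV. V a * Flow (V a))"
    by (simp add: Flow_mult Flow_sum half flip: sum_distrib_left)
  then have "Flow ((\<Sum>a\<in>UNIV. cst (\<omega> a) * V a)
        + cst (1 / 2) * (\<Sum>a\<in>UNIV. V a * V a) + fps_X * formal_compose h f)
    = (\<Sum>a\<in>UNIV. (cst (\<omega> a) + V a) * Flow (V a))
      + fps_X * (\<Sum>a\<in>UNIV. formal_compose h (pd a f) * (cst (\<omega> a) + V a))"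
    by (simp only: Flow_add Flow_mult Flow_sum Flow_cst Flow_X Flow_formal_compose [OF h0] V_def
        distrib_right sum.distrib mult_zero_left add_0_left)
  also have "\<dots> = (\<Sum>a\<in>UNIV. (cst (\<omega> a) + V a) * (Flow (V a) + fps_X * formal_compose h (pd a f)))"
    by (simp only: sum_distrib_left distrib_left sum.distrib mult.left_commute mult.commute)
  also have "\<dots> = 0"
    by (simp add: V_def newton)
  finally show ?thesis unfolding V_def using Flow_eq_0D by blast
qed

text \<open>The pull-back of the symplectic form to the torus is invariant under the quasiperiodic flow,
  hence constant, and it is exact, hence has zero average.\<close>

lemma lagrangian:
  "(\<Sum>a\<in>UNIV. PD i (Flow (h a)) * jacobian h a j) = (\<Sum>a\<in>UNIV. PD j (Flow (h a)) * jacobian h a i)"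
proof -
  define B where "B i j = (\<Sum>a\<in>UNIV. PD i (Flow (h a)) * jacobian h a j)" for i j
  have Flow_B: "Flow (B i j)
      = (\<Sum>a\<in>UNIV. PD i (Flow (h a)) * PD j (Flow (h a)))
        - fps_X * (\<Sum>a\<in>UNIV. \<Sum>b\<in>UNIV. formal_compose h (pd b (pd a f)) * jacobian h b i * jacobian h a j)"
    for i j
  proof -
    have "Flow (B i j) = (\<Sum>a\<in>UNIV. PD i (Flow (Flow (h a))) * jacobian h a j)
        + (\<Sum>a\<in>UNIV. PD i (Flow (h a)) * PD j (Flow (h a)))"
      by (simp add: B_def Flow_sum Flow_mult Flow_PD sum.distrib jacobian_def Flow_add
          if_distrib [of Flow] cong: if_cong)
    moreover have "PD i (Flow (Flow (h a)))
        = - (fps_X * (\<Sum>b\<in>UNIV. formal_compose h (pd b (pd a f)) * jacobian h b i))" for a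
      by (simp add: newton PD_minus PD_mult PD_formal_compose h0)
    ultimately show ?thesis
      by (simp add: sum_negf sum_distrib_left sum_distrib_right mult.assoc)
  qed
  \<comment> \<open>The first sum in \<open>Flow_B\<close> is symmetric in \<open>i\<close> and
    \<open>j\<close>; the second is symmetric because the Hessian of \<open>f\<close> is.\<close>
  have "Flow (B i j - B j i) = 0"
    unfolding Flow_diff Flow_B
    by (subst (2) sum.swap) (simp add: pd_commute mult_ac)
  moreover have "Avg (B i j - B j i) = 0"
  proof -
    \<comment> \<open>Antisymmetrising cancels the mixed second derivatives of \<open>h\<close>,
      leaving total derivatives only.\<close>
    have "B i j - B j i = PD i (Flow (h j)) - PD j (Flow (h i))
        + (\<Sum>a\<in>UNIV. PD i (Flow (h a) * PD j (h a)) - PD j (Flow (h a) * PD i (h a)))"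
      unfolding B_def sum_jacobian
      by (simp add: PD_mult PD_commute [of i j] sum.distrib sum_subtractf)
    then show ?thesis by (simp add: Avg_add Avg_diff Avg_sum)
  qed
  ultimately have "B i j - B j i = embed 0"
    using Flow_eq_0D by metis
  then show ?thesis by (simp add: B_def fps_eq_iff)
qed

end

subsection \<open>The canonical transformation\<close>

lemma cst_add: "cst (r + s) = cst r + cst s"
  and cst_diff: "cst (r - s) = cst r - cst s"
  and cst_mult: "cst (r * s) = cst r * cst s"
  by simp_all

lemma cst_sum: "cst (\<Sum>i\<in>S. r i) = (\<Sum>i\<in>S. cst (r i))"
  by (simp add: fps_eq_iff fps_sum_nth)

text \<open>With \<open>M\<close> the inverse Jacobian this is D h + (1 + \<partial>h)^(-T) p. The
  new momentum \<open>p\<close> is a real parameter, so the coefficients stay in the algebra of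
  functions of the angles.\<close>

definition momentum :: "('n \<Rightarrow> 'a fps) \<Rightarrow> ('n \<Rightarrow> 'n \<Rightarrow> 'a fps) \<Rightarrow> ('n \<Rightarrow> real) \<Rightarrow> 'n \<Rightarrow> 'a fps" where
  "momentum h M p a = Flow (h a) + (\<Sum>i\<in>UNIV. cst (p i) * M i a)"

text \<open>Derivative of the old momentum in the direction with momentum part \<open>u\<close> and
  angle part \<open>v\<close>. The old position is independent of \<open>p\<close>, so its
  differential below takes only \<open>v\<close>.\<close>

definition momentum_differential ::
  "('n \<Rightarrow> 'a fps) \<Rightarrow> ('n \<Rightarrow> 'n \<Rightarrow> 'a fps) \<Rightarrow> ('n \<Rightarrow> real) \<Rightarrow> ('n \<Rightarrow> real) \<Rightarrow> ('n \<Rightarrow> real) \<Rightarrow> 'n \<Rightarrow> 'a fps"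
  where "momentum_differential h M p u v a =
    (\<Sum>k\<in>UNIV. cst (v k) * PD k (momentum h M p a)) + (\<Sum>i\<in>UNIV. cst (u i) * M i a)"

definition position_differential :: "('n \<Rightarrow> 'a fps) \<Rightarrow> ('n \<Rightarrow> real) \<Rightarrow> 'n \<Rightarrow> 'a fps" where
  "position_differential h v a = (\<Sum>k\<in>UNIV. cst (v k) * jacobian h a k)"

section \<open>Canonicity of the transformation and the transformed energy\<close>

context
  fixes h :: "'n \<Rightarrow> 'a fps" and f :: 'a and M :: "'n \<Rightarrow> 'n \<Rightarrow> 'a fps"
  assumes h0: "\<And>a. h a $ 0 = 0"
    and lindstedt: "\<And>a. Flow (Flow (h a)) =
           - (fps_X * (formal_compose h (pd a f) - embed (Avg (formal_compose h (pd a f)))))"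
    and left_inverse: "\<And>i j. (\<Sum>a\<in>UNIV. M i a * jacobian h a j) = (if i = j then 1 else 0)"
begin

text \<open>Differentiating \<open>left_inverse\<close> moves the derivative onto the Jacobian and
  yields the Hessian of \<open>h\<close>, whose symmetry in \<open>l\<close> and \<open>k\<close> is
  the point.\<close>

lemma PD_left_inverse:
  "(\<Sum>a\<in>UNIV. PD l (M i a) * jacobian h a k) = - (\<Sum>a\<in>UNIV. M i a * PD l (PD k (h a)))"
proof -
  have "PD l (\<Sum>a\<in>UNIV. M i a * jacobian h a k) = 0"
    by (simp add: left_inverse)
  then show ?thesis
    by (simp add: PD_sum PD_mult PD_jacobian sum.distrib eq_neg_iff_add_eq_0)
qed

text \<open>The part without \<open>p\<close> is symmetric by \<open>lagrangian\<close>; by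
  \<open>PD_left_inverse\<close> the coefficient of \<open>p i\<close> contracts a Hessian and is
  symmetric too. So every torus of constant \<open>p\<close> has Lagrangian image.\<close>

lemma momentum_lagrangian:
  "(\<Sum>a\<in>UNIV. PD l (momentum h M p a) * jacobian h a k)
    = (\<Sum>a\<in>UNIV. PD k (momentum h M p a) * jacobian h a l)"
proof -
  have "(\<Sum>a\<in>UNIV. PD l (momentum h M p a) * jacobian h a k)
      = (\<Sum>a\<in>UNIV. PD l (Flow (h a)) * jacobian h a k)
        - (\<Sum>i\<in>UNIV. cst (p i) * (\<Sum>a\<in>UNIV. M i a * PD l (PD k (h a))))" for l k
  proof -
    have "(\<Sum>a\<in>UNIV. PD l (momentum h M p a) * jacobian h a k)
      = (\<Sum>a\<in>UNIV. PD l (Flow (h a)) * jacobian h a k)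
        + (\<Sum>a\<in>UNIV. \<Sum>i\<in>UNIV. cst (p i) * (PD l (M i a) * jacobian h a k))"
      by (simp add: momentum_def PD_add PD_sum PD_mult distrib_right sum.distrib sum_distrib_right mult.assoc)
    also have "(\<Sum>a\<in>UNIV. \<Sum>i\<in>UNIV. cst (p i) * (PD l (M i a) * jacobian h a k))
      = (\<Sum>i\<in>UNIV. cst (p i) * (\<Sum>a\<in>UNIV. PD l (M i a) * jacobian h a k))"
      by (subst sum.swap) (simp add: sum_distrib_left)
    finally show ?thesis by (simp add: PD_left_inverse sum_negf)
  qed
  from this [of l k] this [of k l] show ?thesis
    by (simp only: lagrangian [OF h0 lindstedt, of l k] PD_commute [of l k])
qed

text \<open>The angle-angle block \<open>W\<close> is symmetric by
  \<open>momentum_lagrangian\<close> and cancels under antisymmetrisation; the momentum-angle block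
  is \<open>M\<close> times the Jacobian, the identity; a momentum-momentum block is absent.\<close>

lemma symplectic_identity:
  "(\<Sum>a\<in>UNIV. momentum_differential h M p u v a * position_differential h v' a
      - momentum_differential h M p u' v' a * position_differential h v a)
    = cst (\<Sum>a\<in>UNIV. u a * v' a - u' a * v a)"
proof -
  define W where "W l k = (\<Sum>a\<in>UNIV. PD l (momentum h M p a) * jacobian h a k)" for l k
  have *: "(\<Sum>a\<in>UNIV. momentum_differential h M p u v a * position_differential h v' a)
      = (\<Sum>k\<in>UNIV. \<Sum>l\<in>UNIV. cst (v' k) * cst (v l) * W l k) + (\<Sum>k\<in>UNIV. cst (u k) * cst (v' k))"
    for u v v'
  proof -
    have row: "(\<Sum>a\<in>UNIV. momentum_differential h M p u v a * jacobian h a k)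
      = (\<Sum>l\<in>UNIV. cst (v l) * W l k) + cst (u k)" for k
    proof -
      have "(\<Sum>a\<in>UNIV. momentum_differential h M p u v a * jacobian h a k)
          = (\<Sum>a\<in>UNIV. \<Sum>l\<in>UNIV. cst (v l) * (PD l (momentum h M p a) * jacobian h a k))
            + (\<Sum>a\<in>UNIV. \<Sum>i\<in>UNIV. cst (u i) * (M i a * jacobian h a k))"
        by (simp add: momentum_differential_def distrib_right sum.distrib sum_distrib_right mult.assoc)
      also have "\<dots> = (\<Sum>l\<in>UNIV. cst (v l) * W l k)
          + (\<Sum>i\<in>UNIV. cst (u i) * (\<Sum>a\<in>UNIV. M i a * jacobian h a k))"
        unfolding W_def sum_distrib_left by (intro arg_cong2 [where f = "(+)"] sum.swap)
      finally show ?thesis by (simp add: left_inverse mult_delta_right)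
    qed
    have "(\<Sum>a\<in>UNIV. momentum_differential h M p u v a * position_differential h v' a)
      = (\<Sum>k\<in>UNIV. cst (v' k) * (\<Sum>a\<in>UNIV. momentum_differential h M p u v a * jacobian h a k))"
      unfolding position_differential_def sum_distrib_left
      by (subst sum.swap) (simp add: mult.left_commute)
    then show ?thesis
      unfolding row by (simp only: distrib_left sum.distrib sum_distrib_left mult_ac)
  qed
  have "(\<Sum>k\<in>UNIV. \<Sum>l\<in>UNIV. cst (v' k) * cst (v l) * W l k)
      = (\<Sum>k\<in>UNIV. \<Sum>l\<in>UNIV. cst (v k) * cst (v' l) * W l k)"
  proof -
    have "W l k = W k l" for l k
      unfolding W_def by (rule momentum_lagrangian)
    then show ?thesis
      by (subst sum.swap) (simp only: mult.commute)
  qed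
  then show ?thesis
    by (simp only: sum_subtractf * cst_diff cst_sum cst_mult) simp
qed

text \<open>The velocity \<omega> + D h is the Jacobian applied to \<omega>, and \<open>M\<close>
  undoes the Jacobian. Hence the linear term of the energy receives no correction.\<close>

lemma momentum_at_torus:
  "(\<Sum>a\<in>UNIV. (cst (\<omega> a) + Flow (h a)) * (\<Sum>i\<in>UNIV. cst (p i) * M i a)) = cst (\<Sum>i\<in>UNIV. \<omega> i * p i)"
proof -
  have "cst (\<omega> a) + Flow (h a) = (\<Sum>j\<in>UNIV. cst (\<omega> j) * jacobian h a j)" for a
    by (simp add: sum_jacobian' Flow_conv_PD)
  then have "(\<Sum>a\<in>UNIV. (cst (\<omega> a) + Flow (h a)) * (\<Sum>i\<in>UNIV. cst (p i) * M i a))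
      = (\<Sum>a\<in>UNIV. \<Sum>j\<in>UNIV. \<Sum>i\<in>UNIV. cst (\<omega> j) * cst (p i) * (M i a * jacobian h a j))"
    by (simp only: sum_product) (simp only: mult_ac)
  also have "\<dots> = (\<Sum>j\<in>UNIV. \<Sum>a\<in>UNIV. \<Sum>i\<in>UNIV. cst (\<omega> j) * cst (p i) * (M i a * jacobian h a j))"
    by (rule sum.swap)
  also have "\<dots> = (\<Sum>j\<in>UNIV. \<Sum>i\<in>UNIV. cst (\<omega> j) * cst (p i) * (\<Sum>a\<in>UNIV. M i a * jacobian h a j))"
    unfolding sum_distrib_left by (intro sum.cong refl sum.swap)
  also have "\<dots> = (\<Sum>j\<in>UNIV. cst (\<omega> j) * cst (p j))"
    by (simp add: left_inverse mult_delta_right del: fps_const_mult)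
  finally show ?thesis by (simp only: cst_sum cst_mult)
qed

text \<open>Expanding the kinetic energy about the torus: the terms free of \<open>p\<close> form
  the constant energy of the torus, the linear ones are \<open>momentum_at_torus\<close>, and the
  rest is quadratic since the potential does not see \<open>p\<close>.\<close>

lemma energy_normal_form:
  "\<exists>E. \<forall>p. (\<Sum>a\<in>UNIV. cst (\<omega> a) * momentum h M p a)
      + cst (1 / 2) * (\<Sum>a\<in>UNIV. momentum h M p a * momentum h M p a) + fps_X * formal_compose h f
    = embed E + cst (\<Sum>i\<in>UNIV. \<omega> i * p i)
      + (\<Sum>i\<in>UNIV. \<Sum>j\<in>UNIV. cst (p i * p j) * (cst (1 / 2) * (\<Sum>a\<in>UNIV. M i a * M j a)))"
proof -
  obtain E where E: "(\<Sum>a\<in>UNIV. cst (\<omega> a) * Flow (h a))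
      + cst (1 / 2) * (\<Sum>a\<in>UNIV. Flow (h a) * Flow (h a)) + fps_X * formal_compose h f = embed E"
    using energy_constant [OF h0 lindstedt] by blast
  have "(\<Sum>a\<in>UNIV. cst (\<omega> a) * momentum h M p a)
      + cst (1 / 2) * (\<Sum>a\<in>UNIV. momentum h M p a * momentum h M p a) + fps_X * formal_compose h f
    = embed E + cst (\<Sum>i\<in>UNIV. \<omega> i * p i)
      + (\<Sum>i\<in>UNIV. \<Sum>j\<in>UNIV. cst (p i * p j) * (cst (1 / 2) * (\<Sum>a\<in>UNIV. M i a * M j a)))" for p
  proof -
    define Y where "Y a = (\<Sum>i\<in>UNIV. cst (p i) * M i a)" for a
    have "cst (1 / 2) + cst (1 / 2) = 1"
      by (simp flip: cst_add of_real_add)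
    then have half: "cst (1 / 2) * X + cst (1 / 2) * X = X" for X
      by (metis distrib_right mult_1)
    have half_square: "cst (1 / 2) * ((V + Y) * (V + Y))
        = cst (1 / 2) * (V * V) + V * Y + cst (1 / 2) * (Y * Y)" for V Y
    proof -
      have "cst (1 / 2) * ((V + Y) * (V + Y)) = cst (1 / 2) * (V * V)
          + (cst (1 / 2) * (V * Y) + cst (1 / 2) * (V * Y)) + cst (1 / 2) * (Y * Y)"
        by (simp only: distrib_left distrib_right mult.commute add_ac)
      then show ?thesis by (simp only: half)
    qed
    have "(\<Sum>a\<in>UNIV. cst (\<omega> a) * momentum h M p a)
        + cst (1 / 2) * (\<Sum>a\<in>UNIV. momentum h M p a * momentum h M p a) + fps_X * formal_compose h f
      = ((\<Sum>a\<in>UNIV. cst (\<omega> a) * Flow (h a)) + cst (1 / 2) * (\<Sum>a\<in>UNIV. Flow (h a) * Flow (h a))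
          + fps_X * formal_compose h f)
        + (\<Sum>a\<in>UNIV. (cst (\<omega> a) + Flow (h a)) * Y a) + cst (1 / 2) * (\<Sum>a\<in>UNIV. Y a * Y a)"
      unfolding momentum_def Y_def [symmetric] sum_distrib_left half_square
      by (simp only: distrib_left distrib_right sum.distrib add_ac)
    also have "cst (1 / 2) * (\<Sum>a\<in>UNIV. Y a * Y a)
      = (\<Sum>i\<in>UNIV. \<Sum>j\<in>UNIV. cst (p i * p j) * (cst (1 / 2) * (\<Sum>a\<in>UNIV. M i a * M j a)))"
    proof -
      have "cst (1 / 2) * (\<Sum>a\<in>UNIV. Y a * Y a)
        = (\<Sum>a\<in>UNIV. \<Sum>i\<in>UNIV. \<Sum>j\<in>UNIV. cst (p i) * cst (p j) * (cst (1 / 2) * (M i a * M j a)))"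
        by (simp only: Y_def sum_product sum_distrib_left mult_ac)
      also have "\<dots> = (\<Sum>i\<in>UNIV. \<Sum>a\<in>UNIV. \<Sum>j\<in>UNIV. cst (p i) * cst (p j) * (cst (1 / 2) * (M i a * M j a)))"
        by (rule sum.swap)
      also have "\<dots> = (\<Sum>i\<in>UNIV. \<Sum>j\<in>UNIV. \<Sum>a\<in>UNIV. cst (p i) * cst (p j) * (cst (1 / 2) * (M i a * M j a)))"
        by (intro sum.cong refl sum.swap)
      finally show ?thesis by (simp only: sum_distrib_left cst_mult)
    qed
    finally show ?thesis by (simp only: E Y_def momentum_at_torus)
  qed
  then show ?thesis by blast
qed

end

end

unbundle no fps_syntax and vec_syntax

subsection \<open>The algebra of real trigonometric polynomials\<close>

lemma real_vec_0 [simp]: "real_vec 0 = 0"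
  and real_vec_add: "real_vec (k + l) = real_vec k + real_vec l"
  and real_vec_minus: "real_vec (- k) = - real_vec k"
  by (simp_all add: real_vec_def vec_eq_iff)

text \<open>Dropping the reality constraint allows sums to be built from single exponentials, which
  are not real valued one by one.\<close>

definition complex_poly_trig :: "('n::finite phase \<Rightarrow> complex) \<Rightarrow> bool" where
  "complex_poly_trig g \<longleftrightarrow>
     (\<exists>(K :: (int ^ 'n) set) (c :: int ^ 'n \<Rightarrow> real ^ 'n \<Rightarrow> complex).
        finite K \<and> (\<forall>k\<in>K. polynomial_function (c k)) \<and>
        (\<forall>p q. g (p, q) = (\<Sum>k\<in>K. c k p * cis (real_vec k \<bullet> q))))"

lemma poly_trig_polynomial_iff:
  "poly_trig_polynomial g \<longleftrightarrow> complex_poly_trig (\<lambda>z. complex_of_real (g z))"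
  by (simp add: poly_trig_polynomial_def complex_poly_trig_def cis_conv_exp)

lemma trig_polynomial_iff:
  fixes f :: "real ^ 'n::finite \<Rightarrow> real"
  shows "trig_polynomial f \<longleftrightarrow> complex_poly_trig (\<lambda>z. complex_of_real (f (snd z)))"
proof
  assume "trig_polynomial f"
  then obtain K c where "finite K"
    "\<And>q. complex_of_real (f q) = (\<Sum>k\<in>K. c k * cis (real_vec k \<bullet> q))"
    by (auto simp: trig_polynomial_def cis_conv_exp)
  then show "complex_poly_trig (\<lambda>z. complex_of_real (f (snd z)))"
    unfolding complex_poly_trig_def by (intro exI [of _ K] exI [of _ "\<lambda>k p. c k"]) simp
next
  assume "complex_poly_trig (\<lambda>z. complex_of_real (f (snd z)))"
  then obtain K and c :: "int ^ 'n \<Rightarrow> real ^ 'n \<Rightarrow> complex" where "finite K"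
    "\<And>p q. complex_of_real (f (snd (p, q))) = (\<Sum>k\<in>K. c k p * cis (real_vec k \<bullet> q))"
    unfolding complex_poly_trig_def by blast
  then show "trig_polynomial f"
    unfolding trig_polynomial_def
    \<comment> \<open>The function ignores the momentum, so the coefficients may be frozen at
      momentum 0.\<close>
    by (intro exI [of _ K] exI [of _ "\<lambda>k. c k 0"]) (simp add: cis_conv_exp)
qed

lemma complex_poly_trig_monomial:
  assumes "polynomial_function c"
  shows "complex_poly_trig (\<lambda>z. c (fst z) * cis (real_vec k \<bullet> snd z))"
  unfolding complex_poly_trig_def
  by (intro exI [of _ "{k}"] exI [of _ "\<lambda>_. c"]) (simp add: assms)

lemma complex_poly_trig_0: "complex_poly_trig (\<lambda>z. 0)"
  unfolding complex_poly_trig_def by (intro exI [of _ "{}"]) simp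

lemma complex_poly_trig_add:
  assumes "complex_poly_trig g" "complex_poly_trig h"
  shows "complex_poly_trig (\<lambda>z. g z + h z)"
proof -
  obtain K c where K: "finite K" "\<forall>k\<in>K. polynomial_function (c k)"
    "\<And>p q. g (p, q) = (\<Sum>k\<in>K. c k p * cis (real_vec k \<bullet> q))"
    using assms(1) by (auto simp: complex_poly_trig_def)
  obtain J d where J: "finite J" "\<forall>k\<in>J. polynomial_function (d k)"
    "\<And>p q. h (p, q) = (\<Sum>k\<in>J. d k p * cis (real_vec k \<bullet> q))"
    using assms(2) by (auto simp: complex_poly_trig_def)
  have ext: "(\<Sum>k\<in>A. a k p * cis (real_vec k \<bullet> q))
      = (\<Sum>k\<in>K \<union> J. (if k \<in> A then a k p else 0) * cis (real_vec k \<bullet> q))"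
    if "A \<subseteq> K \<union> J" for A a p q
    using that K(1) J(1) by (intro sum.mono_neutral_cong_left) auto
  have poly: "polynomial_function (\<lambda>p. if k \<in> K then c k p else 0)"
    "polynomial_function (\<lambda>p. if k \<in> J then d k p else 0)" for k
    using K(2) J(2) by (cases "k \<in> K"; cases "k \<in> J"; simp)+
  show ?thesis
    unfolding complex_poly_trig_def
  proof (intro exI conjI)
    show "finite (K \<union> J)" using K J by simp
    show "\<forall>k\<in>K \<union> J. polynomial_function
        (\<lambda>p. (if k \<in> K then c k p else 0) + (if k \<in> J then d k p else 0))"
      by (intro ballI polynomial_function_add poly)
    show "\<forall>p q. g (p, q) + h (p, q) = (\<Sum>k\<in>K \<union> J.
        ((if k \<in> K then c k p else 0) + (if k \<in> J then d k p else 0)) * cis (real_vec k \<bullet> q))"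
      unfolding K(3) J(3) distrib_right sum.distrib by (simp add: ext [of K] ext [of J])
  qed
qed

lemma complex_poly_trig_sum:
  assumes "finite S" "\<And>x. x \<in> S \<Longrightarrow> complex_poly_trig (g x)"
  shows "complex_poly_trig (\<lambda>z. \<Sum>x\<in>S. g x z)"
  using assms
  by (induction S rule: finite_induct) (simp_all add: complex_poly_trig_0 complex_poly_trig_add)

lemma poly_trig_polynomial_add:
  assumes "poly_trig_polynomial g" "poly_trig_polynomial h"
  shows "poly_trig_polynomial (\<lambda>z. g z + h z)"
  using complex_poly_trig_add [OF assms [unfolded poly_trig_polynomial_iff]]
  by (simp add: poly_trig_polynomial_iff)

lemma poly_trig_polynomial_sum:
  assumes "finite S" "\<And>x. x \<in> S \<Longrightarrow> poly_trig_polynomial (g x)"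
  shows "poly_trig_polynomial (\<lambda>z. \<Sum>x\<in>S. g x z)"
  using complex_poly_trig_sum [of S "\<lambda>x z. complex_of_real (g x z)"] assms
  by (simp add: poly_trig_polynomial_iff)

lemma trig_polynomial_add:
  assumes "trig_polynomial f" "trig_polynomial g"
  shows "trig_polynomial (\<lambda>q. f q + g q)"
  using complex_poly_trig_add [OF assms [unfolded trig_polynomial_iff]]
  by (simp add: trig_polynomial_iff)

lemma trig_polynomial_const: "trig_polynomial (\<lambda>q. r)"
  using complex_poly_trig_monomial [of "\<lambda>_. complex_of_real r" 0]
  by (simp add: trig_polynomial_iff)

lemma trig_polynomial_mult:
  assumes "trig_polynomial f" "trig_polynomial g"
  shows "trig_polynomial (\<lambda>q. f q * g q)"
proof -
  obtain K c where K: "finite K"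
    "\<And>q. complex_of_real (f q) = (\<Sum>k\<in>K. c k * cis (real_vec k \<bullet> q))"
    using assms(1) by (auto simp: trig_polynomial_def cis_conv_exp)
  obtain J d where J: "finite J"
    "\<And>q. complex_of_real (g q) = (\<Sum>k\<in>J. d k * cis (real_vec k \<bullet> q))"
    using assms(2) by (auto simp: trig_polynomial_def cis_conv_exp)
  have "complex_of_real (f (snd z) * g (snd z))
      = (\<Sum>k\<in>K. \<Sum>l\<in>J. c k * d l * cis (real_vec (k + l) \<bullet> snd z))" for z :: "'a phase"
    unfolding of_real_mult K J sum_product
    by (intro sum.cong) (simp_all add: real_vec_add inner_add_left mult_ac flip: cis_mult)
  then show ?thesis
    unfolding trig_polynomial_iff
    by (simp only:) (intro complex_poly_trig_sum K J complex_poly_trig_monomial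
        polynomial_function_const)
qed

text \<open>The real part of one exponential. Real combinations of such terms need no conjugation
  constraint on the coefficients, at the price of a non-unique representation.\<close>

definition wave :: "complex \<Rightarrow> int ^ 'n::finite \<Rightarrow> real ^ 'n \<Rightarrow> real" where
  "wave c k q = Re c * cos (real_vec k \<bullet> q) - Im c * sin (real_vec k \<bullet> q)"

lemma wave_eq_Re: "wave c k q = Re (c * cis (real_vec k \<bullet> q))"
  by (simp add: wave_def)

lemma wave_scale: "r * wave c k q = wave (of_real r * c) k q"
  by (simp add: wave_def algebra_simps)

lemma wave_sum_coeff: "(\<Sum>i\<in>S. wave (c i) k q) = wave (\<Sum>i\<in>S. c i) k q"
  by (simp add: wave_eq_Re sum_distrib_right)

lemma abs_wave_le: "\<bar>wave c k q\<bar> \<le> cmod c"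
  unfolding wave_eq_Re by (rule order_trans [OF abs_Re_le_cmod]) (simp add: norm_mult)

lemma has_derivative_wave:
  "(wave c k has_derivative (\<lambda>v. (real_vec k \<bullet> v) * wave (\<i> * c) k q)) (at q)"
  unfolding wave_def by (auto intro!: derivative_eq_intros simp: algebra_simps)

text \<open>Taking real parts gives one direction; for the other, a wave is half the sum of its
  exponential and the conjugate one at frequency \<open>- k\<close>.\<close>

lemma trig_polynomial_iff_waves:
  fixes f :: "real ^ 'n::finite \<Rightarrow> real"
  shows "trig_polynomial f \<longleftrightarrow> (\<exists>K c. finite K \<and> f = (\<lambda>q. \<Sum>k\<in>K. wave (c k) k q))"
proof safe
  assume "trig_polynomial f"
  then obtain K c where K: "finite K"
    "\<And>q. complex_of_real (f q) = (\<Sum>k\<in>K. c k * cis (real_vec k \<bullet> q))"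
    by (auto simp: trig_polynomial_def cis_conv_exp)
  have "f q = (\<Sum>k\<in>K. wave (c k) k q)" for q
    using arg_cong [OF K(2), of Re q] by (simp only: wave_eq_Re Re_complex_of_real Re_sum)
  then show "\<exists>K c. finite K \<and> f = (\<lambda>q. \<Sum>k\<in>K. wave (c k) k q)" using K by blast
next
  fix K :: "(int ^ 'n) set" and c :: "int ^ 'n \<Rightarrow> complex" assume "finite K"
  have "complex_of_real (wave (c k) k q)
      = c k / 2 * cis (real_vec k \<bullet> q) + cnj (c k) / 2 * cis (real_vec (- k) \<bullet> q)" for k q
    by (simp add: wave_def complex_eq_iff real_vec_minus field_simps)
  then show "trig_polynomial (\<lambda>q. \<Sum>k\<in>K. wave (c k) k q)"
    unfolding trig_polynomial_iff of_real_sum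
    by (simp only:) (intro complex_poly_trig_sum \<open>finite K\<close> complex_poly_trig_add
        complex_poly_trig_monomial polynomial_function_const)
qed

section \<open>Real trigonometric polynomials as a commutative real algebra\<close>

typedef (overloaded) ('n::finite) trig_poly = "{f :: real ^ 'n \<Rightarrow> real. trig_polynomial f}"
  morphisms eval Trig_poly
  using trig_polynomial_const by blast

setup_lifting type_definition_trig_poly

instantiation trig_poly :: (finite) "{comm_ring_1, real_algebra_1}"
begin

lift_definition zero_trig_poly :: "'a trig_poly" is "\<lambda>q. 0"
  by (rule trig_polynomial_const)

lift_definition one_trig_poly :: "'a trig_poly" is "\<lambda>q. 1"
  by (rule trig_polynomial_const)

lift_definition plus_trig_poly :: "'a trig_poly \<Rightarrow> 'a trig_poly \<Rightarrow> 'a trig_poly"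
  is "\<lambda>f g q. f q + g q"
  by (rule trig_polynomial_add)

lift_definition times_trig_poly :: "'a trig_poly \<Rightarrow> 'a trig_poly \<Rightarrow> 'a trig_poly"
  is "\<lambda>f g q. f q * g q"
  by (rule trig_polynomial_mult)

lift_definition scaleR_trig_poly :: "real \<Rightarrow> 'a trig_poly \<Rightarrow> 'a trig_poly"
  is "\<lambda>r f q. r * f q"
  by (intro trig_polynomial_mult trig_polynomial_const)

lift_definition uminus_trig_poly :: "'a trig_poly \<Rightarrow> 'a trig_poly"
  is "\<lambda>f q. - f q"
  using trig_polynomial_mult [OF trig_polynomial_const [of "- 1"]] by simp

definition minus_trig_poly :: "'a trig_poly \<Rightarrow> 'a trig_poly \<Rightarrow> 'a trig_poly" where
  "x - y = x + - y" for x y :: "'a trig_poly"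

instance
proof
  fix x y z :: "'a trig_poly" and r s :: real
  show "x + y + z = x + (y + z)" "x + y = y + x" "0 + x = x" "- x + x = 0"
    "x * y * z = x * (y * z)" "x * y = y * x" "1 * x = x" "(x + y) * z = x * z + y * z"
    "r *\<^sub>R (x + y) = r *\<^sub>R x + r *\<^sub>R y" "(r + s) *\<^sub>R x = r *\<^sub>R x + s *\<^sub>R x"
    "r *\<^sub>R s *\<^sub>R x = (r * s) *\<^sub>R x" "1 *\<^sub>R x = x"
    "r *\<^sub>R x * y = r *\<^sub>R (x * y)" "x * r *\<^sub>R y = r *\<^sub>R (x * y)" "x * (y + z) = x * y + x * z" "x * 1 = x"
    by (transfer; simp add: algebra_simps)+
  show "(0 :: 'a trig_poly) \<noteq> 1" by transfer (simp add: fun_eq_iff)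
  show "x - y = x + - y" by (rule minus_trig_poly_def)
qed

end

lemma eval_0 [simp]: "eval 0 q = 0"
  and eval_1 [simp]: "eval 1 q = 1"
  and eval_add [simp]: "eval (x + y) q = eval x q + eval y q"
  and eval_mult [simp]: "eval (x * y) q = eval x q * eval y q"
  and eval_scaleR [simp]: "eval (r *\<^sub>R x) q = r * eval x q"
  and eval_minus [simp]: "eval (- x) q = - eval x q"
  by (transfer; simp)+

lemma eval_diff [simp]: "eval (x - y) q = eval x q - eval y q"
  by (simp only: minus_trig_poly_def eval_add eval_minus)

lemma eval_of_real [simp]: "eval (of_real r) q = r"
  by (simp add: of_real_def)

lemma eval_sum [simp]: "eval (\<Sum>i\<in>S. x i) q = (\<Sum>i\<in>S. eval (x i) q)"
  by (induction S rule: infinite_finite_induct) simp_all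

lemma trig_poly_eqI: "(\<And>q. eval x q = eval y q) \<Longrightarrow> x = y"
  by (simp add: eval_inject [symmetric] fun_eq_iff)

lemma trig_poly_cases:
  obtains K c where "finite K" "\<And>q. eval x q = (\<Sum>k\<in>K. wave (c k) k q)"
  using eval [of x] by (auto simp: trig_polynomial_iff_waves)

lemma trig_poly_exists:
  assumes "finite K"
  shows "\<exists>x. \<forall>q. eval x q = (\<Sum>k\<in>K. wave (c k) k q)"
proof (intro exI allI)
  show "eval (Trig_poly (\<lambda>q. \<Sum>k\<in>K. wave (c k) k q)) q = (\<Sum>k\<in>K. wave (c k) k q)" for q
    by (subst Trig_poly_inverse) (use assms trig_polynomial_iff_waves in blast)+
qed

section \<open>Partial derivatives and the operator along the flow\<close>

lemma has_derivative_waves: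
  "((\<lambda>q. \<Sum>k\<in>K. wave (c k) k q) has_derivative
    (\<lambda>v. \<Sum>k\<in>K. (real_vec k \<bullet> v) * wave (\<i> * c k) k q)) (at q)"
  by (intro has_derivative_sum has_derivative_wave)

text \<open>Defined by the Frechet derivative and not on coefficients, because a representation by
  waves is not unique.\<close>

lift_definition trig_pd :: "'n::finite \<Rightarrow> 'n trig_poly \<Rightarrow> 'n trig_poly"
  is "\<lambda>i f q. frechet_derivative f (at q) (axis i 1)"
proof -
  fix i and f :: "real ^ 'n \<Rightarrow> real" assume "trig_polynomial f"
  then obtain K c where K: "finite K" "f = (\<lambda>q. \<Sum>k\<in>K. wave (c k) k q)"
    by (auto simp: trig_polynomial_iff_waves)
  have "frechet_derivative f (at q) (axis i 1)
      = (\<Sum>k\<in>K. wave (of_int (k $ i) * \<i> * c k) k q)" for q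
    unfolding K(2) frechet_derivative_at [OF has_derivative_waves, symmetric]
    by (simp add: inner_axis real_vec_def wave_scale mult.assoc)
  then show "trig_polynomial (\<lambda>q. frechet_derivative f (at q) (axis i 1))"
    using K(1) unfolding trig_polynomial_iff_waves by (intro exI conjI) auto
qed

lemma eval_trig_pd_waves:
  assumes "\<And>q. eval x q = (\<Sum>k\<in>K. wave (c k) k q)"
  shows "eval (trig_pd i x) q = (\<Sum>k\<in>K. wave (of_int (k $ i) * \<i> * c k) k q)"
proof -
  have "eval x = (\<lambda>q. \<Sum>k\<in>K. wave (c k) k q)" using assms by blast
  then show ?thesis
    by (simp add: trig_pd.rep_eq frechet_derivative_at [OF has_derivative_waves, symmetric]
      inner_axis real_vec_def wave_scale mult.assoc)
qed

lemma has_derivative_eval: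
  "(eval x has_derivative (\<lambda>v. \<Sum>i\<in>UNIV. v $ i * eval (trig_pd i x) q)) (at q)"
proof -
  obtain K c where K: "finite K" "\<And>q. eval x q = (\<Sum>k\<in>K. wave (c k) k q)"
    using trig_poly_cases [of x] by blast
  have "(\<lambda>v. \<Sum>k\<in>K. (real_vec k \<bullet> v) * wave (\<i> * c k) k q)
      = (\<lambda>v. \<Sum>i\<in>UNIV. v $ i * eval (trig_pd i x) q)"
    unfolding eval_trig_pd_waves [OF K(2)] inner_vec_def sum_distrib_left sum_distrib_right
    by (rule ext, subst sum.swap) (simp add: wave_scale real_vec_def mult_ac)
  then show ?thesis
    using has_derivative_waves [where K = K and c = c and q = q] K(2) by (simp add: ext [of "eval x", OF K(2)])
qed

lemma eval_trig_pd_eqI: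
  assumes "(eval x has_derivative D) (at q)"
  shows "eval (trig_pd i x) q = D (axis i 1)"
  using frechet_derivative_at [OF assms] by (simp add: trig_pd.rep_eq)

text \<open>The flow derivative multiplies the amplitude at \<open>k\<close> by \<i> times the
  divisor \<open>real_vec k \<bullet> \<omega>\<close>, so it is inverted by division.\<close>

lemma eval_flow_waves:
  assumes "\<And>q. eval x q = (\<Sum>k\<in>K. wave (c k) k q)"
  shows "eval (\<Sum>i\<in>UNIV. \<omega> $ i *\<^sub>R trig_pd i x) q
    = (\<Sum>k\<in>K. wave (of_real (real_vec k \<bullet> \<omega>) * \<i> * c k) k q)"
  unfolding eval_sum eval_scaleR eval_trig_pd_waves [OF assms] sum_distrib_left
  by (subst sum.swap)
     (simp add: wave_scale wave_sum_coeff inner_vec_def real_vec_def sum_distrib_left sum_distrib_right mult_ac)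

lemma diophantine_imp_nonresonant:
  assumes "diophantine \<omega>" "k \<noteq> 0"
  shows "real_vec k \<bullet> \<omega> \<noteq> 0"
proof -
  obtain \<gamma> \<tau> where "\<gamma> > 0" "\<bar>real_vec k \<bullet> \<omega>\<bar> \<ge> \<gamma> * norm (real_vec k) powr (- \<tau>)"
    using assms by (auto simp: diophantine_def)
  moreover have "real_vec k \<noteq> 0"
    using assms(2) by (simp add: real_vec_def vec_eq_iff)
  ultimately show ?thesis
    by (smt (verit, best) mult_pos_pos norm_eq_zero powr_gt_zero)
qed

text \<open>If the second derivative of \<open>x\<close> along the flow vanishes, then \<open>x\<close> is affine along
  every orbit; being bounded, it is constant there.\<close>

lemma second_flow_derivative_eq_0:
  assumes "(\<Sum>i\<in>UNIV. \<omega> $ i *\<^sub>R trig_pd i (\<Sum>i\<in>UNIV. \<omega> $ i *\<^sub>R trig_pd i x)) = 0"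
  shows "(\<Sum>i\<in>UNIV. \<omega> $ i *\<^sub>R trig_pd i x) = 0" (is "?y = 0")
proof (rule trig_poly_eqI)
  fix q
  have deriv: "((\<lambda>t. eval z (q + t *\<^sub>R \<omega>)) has_real_derivative
      eval (\<Sum>i\<in>UNIV. \<omega> $ i *\<^sub>R trig_pd i z) (q + t *\<^sub>R \<omega>)) (at t)" for z t
  proof -
    have "((\<lambda>t. eval z (q + t *\<^sub>R \<omega>)) has_derivative
        (\<lambda>s. \<Sum>i\<in>UNIV. (s *\<^sub>R \<omega>) $ i * eval (trig_pd i z) (q + t *\<^sub>R \<omega>))) (at t)"
      by (rule has_derivative_compose [OF _ has_derivative_eval]) (auto intro!: derivative_eq_intros)
    then show ?thesis
      by (rule has_derivative_imp_has_field_derivative) (simp add: sum_distrib_left mult_ac)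
  qed
  have "\<forall>t. ((\<lambda>t. eval ?y (q + t *\<^sub>R \<omega>)) has_real_derivative 0) (at t)"
    using deriv [of ?y] unfolding assms eval_0 by blast
  from DERIV_isconst_all [OF this, of _ 0] have y: "eval ?y (q + t *\<^sub>R \<omega>) = eval ?y q" for t
    by simp
  have affine: "eval x (q + t *\<^sub>R \<omega>) = eval x q + t * eval ?y q" for t
  proof -
    have "((\<lambda>t. eval x (q + t *\<^sub>R \<omega>) - t * eval ?y q) has_real_derivative 0) (at t)" for t
      using deriv [of x t] unfolding y by (auto intro!: derivative_eq_intros)
    from DERIV_isconst_all [OF allI [OF this], of t 0] show ?thesis by simp
  qed
  obtain K c where K: "finite K" "\<And>q. eval x q = (\<Sum>k\<in>K. wave (c k) k q)"
    using trig_poly_cases [of x] by blast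
  define B where "B = (\<Sum>k\<in>K. cmod (c k))"
  have "\<bar>eval x q\<bar> \<le> B" for q
    unfolding K(2) B_def by (intro order_trans [OF sum_abs] sum_mono abs_wave_le)
  then have bound: "\<bar>t * eval ?y q\<bar> \<le> 2 * B" for t
    using affine [of t] by (smt (verit))
  show "eval ?y q = eval 0 q"
  proof (rule ccontr)
    assume "eval ?y q \<noteq> eval 0 q"
    then show False
      \<comment> \<open>At this time the linear growth reaches \<open>2 * B + 1\<close>, beyond the
        bound.\<close>
      using bound [of "(2 * B + 1) / eval ?y q"] by simp
  qed
qed

lemma quasiperiodic_algebra_trig_pd:
  assumes nonres: "\<And>k. k \<noteq> 0 \<Longrightarrow> real_vec k \<bullet> \<omega> \<noteq> 0"
  shows "quasiperiodic_algebra trig_pd (\<lambda>i. \<omega> $ i)"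
proof
  note has_derivative_eval [derivative_intros]
  fix i j and x y :: "'a trig_poly" and r :: real
  show "trig_pd i (x + y) = trig_pd i x + trig_pd i y"
  proof (rule trig_poly_eqI)
    fix q
    have "(eval (x + y) has_derivative (\<lambda>v. (\<Sum>i\<in>UNIV. v $ i * eval (trig_pd i x) q)
        + (\<Sum>i\<in>UNIV. v $ i * eval (trig_pd i y) q))) (at q)"
      unfolding eval_add [abs_def] by (intro derivative_intros)
    then show "eval (trig_pd i (x + y)) q = eval (trig_pd i x + trig_pd i y) q"
      by (simp add: eval_trig_pd_eqI axis_def mult_delta_left)
  qed
  show "trig_pd i (r *\<^sub>R x) = r *\<^sub>R trig_pd i x"
  proof (rule trig_poly_eqI)
    fix q
    have "(eval (r *\<^sub>R x) has_derivative (\<lambda>v. r * (\<Sum>i\<in>UNIV. v $ i * eval (trig_pd i x) q))) (at q)"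
      unfolding eval_scaleR [abs_def] by (intro derivative_intros)
    then show "eval (trig_pd i (r *\<^sub>R x)) q = eval (r *\<^sub>R trig_pd i x) q"
      by (simp add: eval_trig_pd_eqI axis_def mult_delta_left)
  qed
  show "trig_pd i (x * y) = trig_pd i x * y + x * trig_pd i y"
  proof (rule trig_poly_eqI)
    fix q
    have "(eval (x * y) has_derivative (\<lambda>v. eval x q * (\<Sum>i\<in>UNIV. v $ i * eval (trig_pd i y) q)
        + (\<Sum>i\<in>UNIV. v $ i * eval (trig_pd i x) q) * eval y q)) (at q)"
      unfolding eval_mult [abs_def] by (intro derivative_intros)
    then show "eval (trig_pd i (x * y)) q = eval (trig_pd i x * y + x * trig_pd i y) q"
      by (simp add: eval_trig_pd_eqI axis_def mult_delta_left)
  qed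
  obtain K c where K: "finite K" "\<And>q. eval x q = (\<Sum>k\<in>K. wave (c k) k q)"
    using trig_poly_cases [of x] by blast
  show "trig_pd i (trig_pd j x) = trig_pd j (trig_pd i x)"
    by (rule trig_poly_eqI)
       (simp add: eval_trig_pd_waves [OF eval_trig_pd_waves [OF K(2)]] mult_ac)
  show "(\<Sum>i\<in>UNIV. \<omega> $ i *\<^sub>R trig_pd i x) = 0"
    if "(\<Sum>i\<in>UNIV. \<omega> $ i *\<^sub>R trig_pd i (\<Sum>i\<in>UNIV. \<omega> $ i *\<^sub>R trig_pd i x)) = 0"
    using that by (rule second_flow_derivative_eq_0)
  show "\<exists>r u. x = of_real r + (\<Sum>i\<in>UNIV. \<omega> $ i *\<^sub>R trig_pd i u)"
  proof -
    \<comment> \<open>Division by the eigenvalue solves the equation at all nonzero frequencies;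
      frequency zero contributes just the constant \<open>Re (c 0)\<close>.\<close>
    have "\<exists>u. \<forall>q. eval u q
        = (\<Sum>k\<in>K - {0}. wave (c k / (of_real (real_vec k \<bullet> \<omega>) * \<i>)) k q)"
      by (rule trig_poly_exists) (simp add: K(1))
    then obtain u where u: "\<And>q. eval u q
        = (\<Sum>k\<in>K - {0}. wave (c k / (of_real (real_vec k \<bullet> \<omega>) * \<i>)) k q)"
      by blast
    have "eval x q = (if 0 \<in> K then Re (c 0) else 0) + (\<Sum>k\<in>K - {0}. wave (c k) k q)" for q
      using sum.remove [OF K(1), of 0 "\<lambda>k. wave (c k) k q"]
      by (auto simp: K(2) wave_def)
    then have "x = of_real (if 0 \<in> K then Re (c 0) else 0) + (\<Sum>i\<in>UNIV. \<omega> $ i *\<^sub>R trig_pd i u)"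
      using nonres by (intro trig_poly_eqI) (simp add: eval_flow_waves [OF u] del: eval_sum)
    then show ?thesis by blast
  qed
  show "\<exists>v. trig_pd i x = (\<Sum>i\<in>UNIV. \<omega> $ i *\<^sub>R trig_pd i v)"
  proof -
    \<comment> \<open>At \<open>k = 0\<close> the quotient is 0 by convention, which is the right
      value since the factor \<open>k $ i\<close> vanishes there as well.\<close>
    have "\<exists>v. \<forall>q. eval v q
        = (\<Sum>k\<in>K. wave (of_int (k $ i) * c k / of_real (real_vec k \<bullet> \<omega>)) k q)"
      by (rule trig_poly_exists) (rule K(1))
    then obtain v where v: "\<And>q. eval v q
        = (\<Sum>k\<in>K. wave (of_int (k $ i) * c k / of_real (real_vec k \<bullet> \<omega>)) k q)"
      by blast
    have "of_real (real_vec k \<bullet> \<omega>) * \<i> * (of_int (k $ i) * c k / of_real (real_vec k \<bullet> \<omega>))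
        = of_int (k $ i) * \<i> * c k" for k
      using nonres [of k] by (cases "k = 0") simp_all
    then have "trig_pd i x = (\<Sum>i\<in>UNIV. \<omega> $ i *\<^sub>R trig_pd i v)"
      by (intro trig_poly_eqI) (simp add: eval_flow_waves [OF v] eval_trig_pd_waves [OF K(2)] del: eval_sum)
    then show ?thesis by blast
  qed
qed

subsection \<open>Taylor series of smooth functions\<close>

text \<open>Phrased with iterated \<open>deriv\<close>, the operator in
  \<open>formal_pullback\<close>, whose sum and product rules require differentiability at each
  stage.\<close>

primrec times_differentiable :: "nat \<Rightarrow> (real \<Rightarrow> real) \<Rightarrow> bool" where
  "times_differentiable 0 f \<longleftrightarrow> True"
| "times_differentiable (Suc n) f \<longleftrightarrow>
     (\<forall>x. f field_differentiable at x) \<and> times_differentiable n (deriv f)"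

lemma times_differentiable_SucD: "times_differentiable (Suc n) f \<Longrightarrow> times_differentiable n f"
proof (induction n arbitrary: f)
  case (Suc n)
  then show ?case using Suc.IH [of "deriv f"] by simp
qed simp

lemma times_differentiable_const: "times_differentiable n (\<lambda>x. c)"
  by (induction n arbitrary: c) simp_all

lemma times_differentiable_ident: "times_differentiable n (\<lambda>x. x)"
  by (cases n) (simp_all add: times_differentiable_const)

lemma times_differentiable_add:
  "times_differentiable n f \<Longrightarrow> times_differentiable n g \<Longrightarrow> times_differentiable n (\<lambda>x. f x + g x)"
proof (induction n arbitrary: f g)
  case (Suc n)
  then have "deriv (\<lambda>x. f x + g x) = (\<lambda>x. deriv f x + deriv g x)"
    by (intro ext) (simp add: deriv_add)
  then show ?case using Suc by (simp add: field_differentiable_add)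
qed simp

lemma times_differentiable_mult:
  "times_differentiable n f \<Longrightarrow> times_differentiable n g \<Longrightarrow> times_differentiable n (\<lambda>x. f x * g x)"
proof (induction n arbitrary: f g)
  case (Suc n)
  then have "deriv (\<lambda>x. f x * g x) = (\<lambda>x. f x * deriv g x + deriv f x * g x)"
    by (intro ext) (simp add: deriv_mult)
  moreover have "times_differentiable n f" "times_differentiable n g"
    using Suc.prems by (auto intro: times_differentiable_SucD)
  ultimately show ?case
    using Suc by (simp add: field_differentiable_mult times_differentiable_add)
qed simp

lemma times_differentiable_sum:
  "(\<And>i. i \<in> S \<Longrightarrow> times_differentiable n (f i)) \<Longrightarrow> times_differentiable n (\<lambda>x. \<Sum>i\<in>S. f i x)"
  by (induction S rule: infinite_finite_induct)
     (simp_all add: times_differentiable_const times_differentiable_add)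

definition smooth :: "(real \<Rightarrow> real) \<Rightarrow> bool" where
  "smooth f \<longleftrightarrow> (\<forall>n. times_differentiable n f)"

lemma smooth_imp_field_differentiable: "smooth f \<Longrightarrow> f field_differentiable at x"
  unfolding smooth_def by (auto dest: spec [of _ "Suc 0"])

lemma smooth_deriv: "smooth f \<Longrightarrow> smooth (deriv f)"
  unfolding smooth_def by (metis times_differentiable.simps(2))

lemma smooth_const: "smooth (\<lambda>x. c)"
  and smooth_ident: "smooth (\<lambda>x. x)"
  and smooth_add: "smooth f \<Longrightarrow> smooth g \<Longrightarrow> smooth (\<lambda>x. f x + g x)"
  and smooth_mult: "smooth f \<Longrightarrow> smooth g \<Longrightarrow> smooth (\<lambda>x. f x * g x)"
  and smooth_sum: "(\<And>i. i \<in> S \<Longrightarrow> smooth (F i)) \<Longrightarrow> smooth (\<lambda>x. \<Sum>i\<in>S. F i x)"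
  unfolding smooth_def
  by (simp_all add: times_differentiable_const times_differentiable_ident times_differentiable_add
      times_differentiable_mult times_differentiable_sum)

lemma smooth_power: "smooth (\<lambda>x. x ^ n)"
  by (induction n) (simp_all add: smooth_const smooth_mult smooth_ident)

lemmas smooth_intros = smooth_const smooth_ident smooth_add smooth_mult smooth_sum smooth_power

text \<open>Collects the coefficients taken in \<open>formal_pullback\<close>; on smooth functions
  it respects sums and products, so analytic substitution turns into power series algebra.\<close>

definition taylor :: "(real \<Rightarrow> real) \<Rightarrow> real fps" where
  "taylor f = Abs_fps (\<lambda>n. (deriv ^^ n) f 0 / fact n)"

lemma taylor_nth_0 [simp]: "fps_nth (taylor f) 0 = f 0"
  by (simp add: taylor_def)

lemma taylor_nth_Suc: "fps_nth (taylor f) (Suc n) = fps_nth (taylor (deriv f)) n / (1 + real n)"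
  by (simp add: taylor_def funpow_Suc_right del: funpow.simps)

lemma fps_deriv_taylor: "fps_deriv (taylor f) = taylor (deriv f)"
  by (rule fps_ext) (simp add: taylor_nth_Suc add_nonneg_eq_0_iff)

lemma taylor_const [simp]: "taylor (\<lambda>x. c) = fps_const c"
proof (rule fps_ext)
  show "fps_nth (taylor (\<lambda>x. c)) n = fps_nth (fps_const c) n" for n
    by (induction n arbitrary: c) (simp_all add: taylor_nth_Suc)
qed

lemma taylor_ident [simp]: "taylor (\<lambda>x. x) = fps_X"
proof (rule fps_ext)
  show "fps_nth (taylor (\<lambda>x. x)) n = fps_nth fps_X n" for n
    by (cases n) (simp_all add: taylor_nth_Suc fps_X_def)
qed

lemma taylor_add:
  assumes "smooth f" "smooth g"
  shows "taylor (\<lambda>x. f x + g x) = taylor f + taylor g"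
proof (rule fps_ext)
  show "fps_nth (taylor (\<lambda>x. f x + g x)) n = fps_nth (taylor f + taylor g) n" for n
    using assms
  proof (induction n arbitrary: f g)
    case (Suc n)
    have "deriv (\<lambda>x. f x + g x) = (\<lambda>x. deriv f x + deriv g x)"
      using Suc.prems by (intro ext) (simp add: deriv_add smooth_imp_field_differentiable)
    then show ?case
      using Suc.IH [of "deriv f" "deriv g"] Suc.prems
      by (simp add: taylor_nth_Suc smooth_deriv add_divide_distrib)
  qed simp
qed

text \<open>Both sides have matching derivatives by the product rule and the induction hypothesis,
  so the next coefficient agrees; binomial sums are avoided.\<close>

lemma taylor_mult:
  assumes "smooth f" "smooth g"
  shows "taylor (\<lambda>x. f x * g x) = taylor f * taylor g"
proof (rule fps_ext)
  show "fps_nth (taylor (\<lambda>x. f x * g x)) n = fps_nth (taylor f * taylor g) n" for n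
    using assms
  proof (induction n arbitrary: f g)
    case (Suc n)
    note diff = Suc.prems [THEN smooth_imp_field_differentiable]
      and smooth = Suc.prems Suc.prems [THEN smooth_deriv]
    have "deriv (\<lambda>x. f x * g x) = (\<lambda>x. f x * deriv g x + deriv f x * g x)"
      by (intro ext) (simp add: deriv_mult diff)
    then have "fps_nth (taylor (deriv (\<lambda>x. f x * g x))) n = fps_nth (fps_deriv (taylor f * taylor g)) n"
      by (simp add: taylor_add smooth_mult smooth Suc.IH fps_deriv_taylor)
    moreover have "fps_nth F (Suc n) = fps_nth (fps_deriv F) n / (1 + real n)" for F :: "real fps"
      by (simp add: add_nonneg_eq_0_iff)
    ultimately show ?case
      by (metis taylor_nth_Suc)
  qed simp
qed

lemma taylor_sum:
  assumes "\<And>i. i \<in> S \<Longrightarrow> smooth (F i)"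
  shows "taylor (\<lambda>x. \<Sum>i\<in>S. F i x) = (\<Sum>i\<in>S. taylor (F i))"
  using assms
  by (induction S rule: infinite_finite_induct) (simp_all add: taylor_add smooth_sum)

lemma taylor_power: "taylor (\<lambda>x. x ^ n) = fps_X ^ n"
  by (induction n) (simp_all add: taylor_mult smooth_ident smooth_power)

lemma taylor_polynomial_nth:
  "n \<le> N \<Longrightarrow> fps_nth (taylor (\<lambda>x. \<Sum>j\<le>N. x ^ j * c j)) n = c n"
  by (simp add: taylor_sum taylor_mult taylor_power smooth_intros fps_sum_nth fps_X_power_nth
      mult_delta_left)

section \<open>Trigonometric polynomials along smooth curves\<close>

lemma deriv_eval_comp:
  assumes "\<And>a. (\<lambda>\<epsilon>. r \<epsilon> $ a) field_differentiable at \<epsilon>"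
  shows "((\<lambda>\<epsilon>. eval x (r \<epsilon>)) has_real_derivative
    (\<Sum>a\<in>UNIV. eval (trig_pd a x) (r \<epsilon>) * deriv (\<lambda>\<epsilon>. r \<epsilon> $ a) \<epsilon>)) (at \<epsilon>)"
proof -
  have "((\<lambda>\<epsilon>. \<chi> a. r \<epsilon> $ a) has_derivative (\<lambda>t. \<chi> a. deriv (\<lambda>\<epsilon>. r \<epsilon> $ a) \<epsilon> * t)) (at \<epsilon>)"
    using assms
    by (subst has_derivative_componentwise_within)
       (auto simp: Basis_vec_def inner_axis field_differentiable_derivI has_field_derivative_imp_has_derivative)
  then have "(r has_derivative (\<lambda>t. \<chi> a. deriv (\<lambda>\<epsilon>. r \<epsilon> $ a) \<epsilon> * t)) (at \<epsilon>)"
    by simp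
  from has_derivative_compose [OF this has_derivative_eval [of x]] show ?thesis
    by (rule has_derivative_imp_has_field_derivative) (simp add: sum_distrib_left mult_ac)
qed

text \<open>The derivative is again built from compositions, of the partial derivatives of
  \<open>x\<close>, so the induction runs over all \<open>x\<close> at once.\<close>

lemma smooth_eval_comp:
  assumes "\<And>a. smooth (\<lambda>\<epsilon>. r \<epsilon> $ a)"
  shows "smooth (\<lambda>\<epsilon>. eval x (r \<epsilon>))"
proof -
  note deriv = deriv_eval_comp [OF smooth_imp_field_differentiable [OF assms]]
  have "times_differentiable n (\<lambda>\<epsilon>. eval x (r \<epsilon>))" for n
  proof (induction n arbitrary: x)
    case (Suc n)
    have "(\<lambda>\<epsilon>. eval x (r \<epsilon>)) field_differentiable at \<epsilon>" for \<epsilon>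
      using deriv field_differentiable_def by blast
    moreover have "times_differentiable n (deriv (\<lambda>\<epsilon>. eval x (r \<epsilon>)))"
      unfolding DERIV_imp_deriv [OF deriv, abs_def]
      using Suc.IH smooth_deriv [OF assms]
      by (intro times_differentiable_sum times_differentiable_mult) (auto simp: smooth_def)
    ultimately show ?case by simp
  qed simp
  then show ?thesis by (simp add: smooth_def)
qed

lemma fps_deriv_taylor_eval_comp:
  assumes "\<And>a. smooth (\<lambda>\<epsilon>. r \<epsilon> $ a)"
  shows "fps_deriv (taylor (\<lambda>\<epsilon>. eval x (r \<epsilon>)))
    = (\<Sum>a\<in>UNIV. taylor (\<lambda>\<epsilon>. eval (trig_pd a x) (r \<epsilon>)) * fps_deriv (taylor (\<lambda>\<epsilon>. r \<epsilon> $ a)))"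
  unfolding fps_deriv_taylor
    DERIV_imp_deriv [OF deriv_eval_comp [OF smooth_imp_field_differentiable [OF assms]], abs_def]
  by (simp add: taylor_sum taylor_mult smooth_mult smooth_eval_comp assms smooth_deriv)

locale nonresonant_frequency =
  fixes \<omega> :: "real ^ 'n::finite"
  assumes nonresonant: "k \<noteq> 0 \<Longrightarrow> real_vec k \<bullet> \<omega> \<noteq> 0"

sublocale nonresonant_frequency \<subseteq> quasiperiodic_algebra trig_pd "\<lambda>i. \<omega> $ i"
  by (rule quasiperiodic_algebra_trig_pd [OF nonresonant])

context nonresonant_frequency
begin

text \<open>Both series obey the same differential system in \<epsilon> and start at
  \<open>eval x q\<close>. Order zero is excluded from the coefficient condition: there
  \<open>r\<close> equals \<open>q\<close>, and only the derivative of \<open>h\<close> enters the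
  system.\<close>

lemma taylor_eval_comp:
  assumes smooth: "\<And>a. smooth (\<lambda>\<epsilon>. r \<epsilon> $ a)"
    and start: "r 0 = q"
    and coeff: "\<And>a j. 0 < j \<Longrightarrow> j \<le> N \<Longrightarrow> fps_nth (taylor (\<lambda>\<epsilon>. r \<epsilon> $ a)) j = eval (fps_nth (h a) j) q"
    and "n \<le> N"
  shows "fps_nth (taylor (\<lambda>\<epsilon>. eval x (r \<epsilon>))) n = eval (fps_nth (formal_compose h x) n) q"
  using \<open>n \<le> N\<close>
proof (induction n arbitrary: x rule: less_induct)
  case (less n)
  show ?case
  proof (cases n)
    case 0
    then show ?thesis by (simp add: start)
  next
    case (Suc m)
    have of_nat: "eval (of_nat k) q = of_nat k" for k
      using eval_of_real [of "of_nat k" q] by simp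
    have "of_nat (Suc m) * fps_nth (taylor (\<lambda>\<epsilon>. eval x (r \<epsilon>))) (Suc m)
        = fps_nth (fps_deriv (taylor (\<lambda>\<epsilon>. eval x (r \<epsilon>)))) m"
      by simp
    also have "\<dots> = eval (fps_nth (fps_deriv (formal_compose h x)) m) q"
      unfolding fps_deriv_taylor_eval_comp [OF smooth] fps_deriv_formal_compose fps_sum_nth
        fps_mult_nth eval_sum eval_mult
    proof (intro sum.cong refl arg_cong2 [where f = "(*)"])
      fix a i assume "i \<in> {0..m}"
      then show "fps_nth (taylor (\<lambda>\<epsilon>. eval (trig_pd a x) (r \<epsilon>))) i
          = eval (fps_nth (formal_compose h (trig_pd a x)) i) q"
        using Suc less.prems by (intro less.IH) auto
      show "fps_nth (fps_deriv (taylor (\<lambda>\<epsilon>. r \<epsilon> $ a))) (m - i)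
          = eval (fps_nth (fps_deriv (h a)) (m - i)) q"
        using coeff [of "Suc (m - i)" a] Suc less.prems by (simp add: of_nat del: of_nat_Suc of_nat_add)
    qed
    also have "\<dots> = of_nat (Suc m) * eval (fps_nth (formal_compose h x) (Suc m)) q"
      by (simp add: of_nat del: of_nat_Suc of_nat_add)
    finally show ?thesis unfolding Suc by (simp del: of_nat_Suc)
  qed
qed

subsection \<open>Kolmogorov's normal form\<close>

text \<open>The angle itself is not an element of the algebra and is added at order zero only, as in
  the Jacobian.\<close>

definition transformation ::
  "('n \<Rightarrow> 'n trig_poly fps) \<Rightarrow> ('n \<Rightarrow> 'n \<Rightarrow> 'n trig_poly fps) \<Rightarrow> nat \<Rightarrow> 'n phase \<Rightarrow> 'n phase"
  where "transformation h M s z =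
    (\<chi> a. eval (fps_nth (momentum h M (($) (fst z)) a) s) (snd z),
     \<chi> a. eval (fps_nth (h a) s) (snd z) + (if s = 0 then snd z $ a else 0))"

lemma poly_trig_polynomial_eval_mult:
  assumes "real_polynomial_function w"
  shows "poly_trig_polynomial (\<lambda>z. w (fst z) * eval x (snd z))"
proof -
  obtain K c where K: "finite K"
    "\<And>q. complex_of_real (eval x q) = (\<Sum>k\<in>K. c k * exp (\<i> * complex_of_real (real_vec k \<bullet> q)))"
    using eval [of x] by (auto simp: trig_polynomial_def)
  have "polynomial_function (\<lambda>p. w p *\<^sub>R c k)" for k
    using assms by (intro polynomial_function_mult) (auto simp: real_polynomial_function_eq)
  moreover have "complex_of_real (w p * eval x q)
      = (\<Sum>k\<in>K. (w p *\<^sub>R c k) * exp (\<i> * complex_of_real (real_vec k \<bullet> q)))" for p q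
    by (simp add: K(2) sum_distrib_left scaleR_conv_of_real mult_ac)
  ultimately show ?thesis
    unfolding poly_trig_polynomial_def using K(1)
    by (intro exI [of _ K] exI [of _ "\<lambda>k p. w p *\<^sub>R c k"]) simp
qed

lemma real_polynomial_function_nth: "real_polynomial_function (\<lambda>p :: real ^ 'n. p $ i)"
  by (intro real_polynomial_function.intros(1) bounded_linear_vec_nth)

lemma poly_trig_polynomial_eval: "poly_trig_polynomial (\<lambda>z. eval x (snd z))"
  using poly_trig_polynomial_eval_mult [OF real_polynomial_function.intros(2) [of 1], of x] by simp

lemma eval_momentum:
  "eval (fps_nth (momentum h M p a) s) q
    = eval (fps_nth (Flow (h a)) s) q + (\<Sum>i\<in>UNIV. p i * eval (fps_nth (M i a) s) q)"
  by (simp add: momentum_def fps_sum_nth)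

text \<open>Identifies the Frechet derivative with the algebraic differentials, so that canonicity
  reduces to \<open>symplectic_identity\<close>.\<close>

lemma has_derivative_transformation:
  "(transformation h M s has_derivative (\<lambda>w.
      (\<chi> a. eval (fps_nth (momentum_differential h M (($) (fst z)) (($) (fst w)) (($) (snd w)) a) s) (snd z),
       \<chi> a. eval (fps_nth (position_differential h (($) (snd w)) a) s) (snd z)))) (at z)"
proof -
  have vec: "((\<lambda>z. \<chi> a. F a z) has_derivative (\<lambda>w. \<chi> a. F' a w)) (at z)"
    if "\<And>a. (F a has_derivative F' a) (at z)" for F F' :: "'n \<Rightarrow> 'n phase \<Rightarrow> real"
    using that by (subst has_derivative_componentwise_within) (auto simp: Basis_vec_def inner_axis)
  have comp: "((\<lambda>z. eval x (snd z)) has_derivative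
      (\<lambda>w. \<Sum>k\<in>UNIV. snd w $ k * eval (trig_pd k x) (snd z))) (at z)" for x
    by (rule has_derivative_compose [OF _ has_derivative_eval]) (auto intro!: derivative_eq_intros)
  note bounded_linear.has_derivative [OF bounded_linear_vec_nth, derivative_intros]
  have "((\<lambda>z. eval (fps_nth (momentum h M (($) (fst z)) a) s) (snd z)) has_derivative
      (\<lambda>w. eval (fps_nth (momentum_differential h M (($) (fst z)) (($) (fst w)) (($) (snd w)) a) s) (snd z)))
      (at z)" for a
  proof -
    have deriv: "((\<lambda>z. eval (fps_nth (momentum h M (($) (fst z)) a) s) (snd z)) has_derivative
        (\<lambda>w. (\<Sum>k\<in>UNIV. snd w $ k * eval (trig_pd k (fps_nth (Flow (h a)) s)) (snd z))
          + (\<Sum>i\<in>UNIV. fst z $ i * (\<Sum>k\<in>UNIV. snd w $ k * eval (trig_pd k (fps_nth (M i a) s)) (snd z))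
               + fst w $ i * eval (fps_nth (M i a) s) (snd z)))) (at z)"
      unfolding eval_momentum by (intro derivative_intros comp)
    have swap: "(\<Sum>i\<in>UNIV. fst z $ i * (\<Sum>k\<in>UNIV. snd w $ k * eval (trig_pd k (fps_nth (M i a) s)) (snd z)))
        = (\<Sum>k\<in>UNIV. snd w $ k * (\<Sum>i\<in>UNIV. fst z $ i * eval (trig_pd k (fps_nth (M i a) s)) (snd z)))" for w
      unfolding sum_distrib_left by (subst sum.swap) (simp add: mult_ac)
    have "eval (fps_nth (momentum_differential h M (($) (fst z)) (($) (fst w)) (($) (snd w)) a) s) (snd z)
        = (\<Sum>k\<in>UNIV. snd w $ k * eval (trig_pd k (fps_nth (Flow (h a)) s)) (snd z))
          + (\<Sum>k\<in>UNIV. snd w $ k * (\<Sum>i\<in>UNIV. fst z $ i * eval (trig_pd k (fps_nth (M i a) s)) (snd z)))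
          + (\<Sum>i\<in>UNIV. fst w $ i * eval (fps_nth (M i a) s) (snd z))" for w
      by (simp add: momentum_differential_def momentum_def fps_sum_nth PD_add PD_sum PD_mult
          sum.distrib distrib_left)
    then show ?thesis
      using deriv by (simp only: swap sum.distrib add.assoc)
  qed
  moreover have "((\<lambda>z. eval (fps_nth (h a) s) (snd z) + (if s = 0 then snd z $ a else 0)) has_derivative
      (\<lambda>w. eval (fps_nth (position_differential h (($) (snd w)) a) s) (snd z))) (at z)" for a
  proof -
    have "((\<lambda>z. if s = 0 then snd z $ a else 0) has_derivative (\<lambda>w. if s = 0 then snd w $ a else 0)) (at z)"
      by (cases "s = 0") (auto intro!: derivative_intros)
    from has_derivative_add [OF comp this] show ?thesis
      by (simp add: position_differential_def jacobian_nth fps_sum_nth distrib_left sum.distrib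
          mult_delta_right if_distrib [of "\<lambda>x. eval x _"] if_distrib [of "(*) _"] add_ac cong: if_cong)
  qed
  ultimately show ?thesis
    unfolding transformation_def by (intro has_derivative_Pair vec)
qed

section \<open>Verification for a Lindstedt series with its inverse Jacobian\<close>

context
  fixes h :: "'n \<Rightarrow> 'n trig_poly fps" and f :: "'n trig_poly" and M :: "'n \<Rightarrow> 'n \<Rightarrow> 'n trig_poly fps"
  assumes h0: "\<And>a. fps_nth (h a) 0 = 0"
    and lindstedt: "\<And>a. Flow (Flow (h a)) =
      - (fps_X * (formal_compose h (trig_pd a f) - embed (Avg (formal_compose h (trig_pd a f)))))"
    and left_inverse: "\<And>i j. (\<Sum>a\<in>UNIV. M i a * jacobian h a j) = (if i = j then 1 else 0)"
    and M0: "\<And>i a. fps_nth (M i a) 0 = (if i = a then 1 else 0)"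
begin

lemma formal_transformation_transformation: "formal_transformation (transformation h M)"
proof -
  have "transformation h M 0 = id"
  proof
    fix z show "transformation h M 0 z = id z"
      by (cases z) (simp add: transformation_def eval_momentum h0 M0 vec_eq_iff
          if_distrib [of "\<lambda>x. eval x _"] mult_delta_right cong: if_cong)
  qed
  moreover have "poly_trig_polynomial (\<lambda>z. eval (fps_nth (momentum h M (($) (fst z)) a) s) (snd z))" for a s
    unfolding eval_momentum
    by (intro poly_trig_polynomial_add poly_trig_polynomial_eval poly_trig_polynomial_sum
        poly_trig_polynomial_eval_mult real_polynomial_function_nth finite)
  ultimately show ?thesis
    by (simp add: formal_transformation_def transformation_def poly_trig_polynomial_eval)
qed

lemma canonical_transformation_transformation: "canonical_transformation (transformation h M)"
  unfolding canonical_transformation_def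
proof (intro allI)
  fix s and z u v :: "'n phase"
  define p where "p = ($) (fst z)"
  define A where "A w a = momentum_differential h M p (($) (fst w)) (($) (snd w)) a" for w :: "'n phase" and a
  define B where "B w a = position_differential h (($) (snd w)) a" for w :: "'n phase" and a
  have D: "frechet_derivative (transformation h M j) (at z) w =
      (\<chi> a. eval (fps_nth (A w a) j) (snd z), \<chi> a. eval (fps_nth (B w a) j) (snd z))" for j w
    unfolding frechet_derivative_at [OF has_derivative_transformation, symmetric]
    by (simp add: A_def B_def p_def)
  \<comment> \<open>The convolution over orders in the definition of canonicity is a coefficient of
    a product of series.\<close>
  have nth: "eval (fps_nth (\<Sum>a\<in>UNIV. X a * Y a) s) q
      = (\<Sum>j\<le>s. \<Sum>a\<in>UNIV. eval (fps_nth (X a) j) q * eval (fps_nth (Y a) (s - j)) q)" for X Y q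
    by (simp add: fps_sum_nth fps_mult_nth atLeast0AtMost) (rule sum.swap)
  have "(\<Sum>j\<le>s. symplectic_form (frechet_derivative (transformation h M j) (at z) u)
        (frechet_derivative (transformation h M (s - j)) (at z) v))
      = eval (fps_nth (\<Sum>a\<in>UNIV. A u a * B v a) s) (snd z)
        - eval (fps_nth (\<Sum>a\<in>UNIV. B u a * A v a) s) (snd z)"
    unfolding nth D symplectic_form_def
    by (simp add: inner_vec_def sum_subtractf mult.commute)
  also have "\<dots> = eval (fps_nth (\<Sum>a\<in>UNIV. A u a * B v a - A v a * B u a) s) (snd z)"
    by (simp add: sum_subtractf mult.commute)
  also have "\<dots> = (if s = 0 then symplectic_form u v else 0)"
    unfolding A_def B_def symplectic_identity [OF h0 lindstedt left_inverse]
    by (simp add: symplectic_form_def inner_vec_def sum_subtractf)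
  finally show "(\<Sum>j\<le>s. symplectic_form (frechet_derivative (transformation h M j) (at z) u)
        (frechet_derivative (transformation h M (s - j)) (at z) v))
      = (if s = 0 then symplectic_form u v else 0)" .
qed

text \<open>The truncated momenta and positions \<open>P\<close> and \<open>Q\<close> have the
  prescribed Taylor coefficients through order \<open>s\<close>, and coefficient \<open>s\<close> of
  the Hamiltonian depends on no others.\<close>

lemma formal_pullback_hamiltonian:
  "formal_pullback (hamiltonian \<omega> (eval f)) (transformation h M) s (p, q)
    = eval (fps_nth ((\<Sum>a\<in>UNIV. cst (\<omega> $ a) * momentum h M (($) p) a)
        + cst (1 / 2) * (\<Sum>a\<in>UNIV. momentum h M (($) p) a * momentum h M (($) p) a)
        + fps_X * formal_compose h f) s) q"
proof -
  define P where "P a \<epsilon> = (\<Sum>j\<le>s. \<epsilon> ^ j * eval (fps_nth (momentum h M (($) p) a) j) q)" for a and \<epsilon> :: real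
  define Q where "Q \<epsilon> = (\<chi> a. \<Sum>j\<le>s. \<epsilon> ^ j * (eval (fps_nth (h a) j) q + (if j = 0 then q $ a else 0)))"
    for \<epsilon> :: real
  have smooth: "smooth (P a)" "smooth (\<lambda>\<epsilon>. Q \<epsilon> $ a)" for a
    unfolding P_def Q_def by (simp_all add: smooth_intros)
  have taylor_P: "fps_nth (taylor (P a)) j = eval (fps_nth (momentum h M (($) p) a) j) q" if "j \<le> s" for a j
    unfolding P_def using that by (rule taylor_polynomial_nth)
  have taylor_Q: "fps_nth (taylor (\<lambda>\<epsilon>. Q \<epsilon> $ a)) j
      = eval (fps_nth (h a) j) q + (if j = 0 then q $ a else 0)" if "j \<le> s" for a j
    unfolding Q_def vec_lambda_beta using that by (rule taylor_polynomial_nth)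
  have "Q 0 = q"
    using taylor_Q [of 0] by (simp add: vec_eq_iff h0)
  then have taylor_f: "fps_nth (taylor (\<lambda>\<epsilon>. eval f (Q \<epsilon>))) n = eval (fps_nth (formal_compose h f) n) q"
    if "n \<le> s" for n
    using that by (intro taylor_eval_comp [where N = s and h = h] smooth) (simp_all add: taylor_Q)
  have "(\<lambda>\<epsilon>. hamiltonian \<omega> (eval f) \<epsilon> (\<Sum>j\<le>s. \<epsilon> ^ j *\<^sub>R transformation h M j (p, q)))
      = (\<lambda>\<epsilon>. (\<Sum>a\<in>UNIV. \<omega> $ a * P a \<epsilon>) + (1 / 2) * (\<Sum>a\<in>UNIV. P a \<epsilon> * P a \<epsilon>) + \<epsilon> * eval f (Q \<epsilon>))"
  proof
    fix \<epsilon> :: real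
    have "(\<Sum>j\<le>s. \<epsilon> ^ j *\<^sub>R transformation h M j (p, q)) = (\<chi> a. P a \<epsilon>, Q \<epsilon>)"
      by (simp add: prod_eq_iff fst_sum snd_sum transformation_def vec_eq_iff P_def Q_def cong: if_cong)
    then show "hamiltonian \<omega> (eval f) \<epsilon> (\<Sum>j\<le>s. \<epsilon> ^ j *\<^sub>R transformation h M j (p, q))
      = (\<Sum>a\<in>UNIV. \<omega> $ a * P a \<epsilon>) + (1 / 2) * (\<Sum>a\<in>UNIV. P a \<epsilon> * P a \<epsilon>) + \<epsilon> * eval f (Q \<epsilon>)"
      by (simp add: hamiltonian_def inner_vec_def)
  qed
  then have "formal_pullback (hamiltonian \<omega> (eval f)) (transformation h M) s (p, q)
      = fps_nth (taylor (\<lambda>\<epsilon>. (\<Sum>a\<in>UNIV. \<omega> $ a * P a \<epsilon>) + (1 / 2) * (\<Sum>a\<in>UNIV. P a \<epsilon> * P a \<epsilon>)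
          + \<epsilon> * eval f (Q \<epsilon>))) s"
    by (simp add: formal_pullback_def taylor_def)
  also have "\<dots> = fps_nth ((\<Sum>a\<in>UNIV. fps_const (\<omega> $ a) * taylor (P a))
      + fps_const (1 / 2) * (\<Sum>a\<in>UNIV. taylor (P a) * taylor (P a))
      + fps_X * taylor (\<lambda>\<epsilon>. eval f (Q \<epsilon>))) s"
    by (simp only: taylor_add taylor_mult taylor_sum taylor_const taylor_ident smooth_intros
        smooth smooth_eval_comp)
  also have "\<dots> = eval (fps_nth ((\<Sum>a\<in>UNIV. cst (\<omega> $ a) * momentum h M (($) p) a)
        + cst (1 / 2) * (\<Sum>a\<in>UNIV. momentum h M (($) p) a * momentum h M (($) p) a)
        + fps_X * formal_compose h f) s) q"
  proof -
    \<comment> \<open>Truncation alters orders above \<open>s\<close>, so the series are compared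
      only up to \<open>s\<close>. This relation survives products, whose coefficients involve no
      higher orders of the factors.\<close>
    define agree where "agree F X \<longleftrightarrow> (\<forall>n\<le>s. fps_nth F n = eval (fps_nth X n) q)" for F X
    have add: "agree (F + G) (X + Y)" and mult: "agree (F * G) (X * Y)"
      if "agree F X" "agree G Y" for F G X Y
      using that by (simp_all add: agree_def fps_mult_nth)
    have sum: "agree (\<Sum>a\<in>UNIV. F a) (\<Sum>a\<in>UNIV. X a)" if "\<And>a. agree (F a) (X a)"
      for F :: "'n \<Rightarrow> real fps" and X
      using that by (simp add: agree_def fps_sum_nth)
    have const: "agree (fps_const c) (cst c)" and X: "agree fps_X fps_X" for c
      by (simp_all add: agree_def fps_X_def)
    have P: "agree (taylor (P a)) (momentum h M (($) p) a)"
      and f: "agree (taylor (\<lambda>\<epsilon>. eval f (Q \<epsilon>))) (formal_compose h f)" for a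
      by (simp_all add: agree_def taylor_P taylor_f)
    have "agree ((\<Sum>a\<in>UNIV. fps_const (\<omega> $ a) * taylor (P a))
        + fps_const (1 / 2) * (\<Sum>a\<in>UNIV. taylor (P a) * taylor (P a))
        + fps_X * taylor (\<lambda>\<epsilon>. eval f (Q \<epsilon>)))
      ((\<Sum>a\<in>UNIV. cst (\<omega> $ a) * momentum h M (($) p) a)
        + cst (1 / 2) * (\<Sum>a\<in>UNIV. momentum h M (($) p) a * momentum h M (($) p) a)
        + fps_X * formal_compose h f)"
      by (intro add mult sum const X P f)
    then show ?thesis by (simp add: agree_def)
  qed
  finally show ?thesis .
qed

text \<open>Reads \<open>energy_normal_form\<close> coefficientwise. The remainder is the quadratic
  form with matrix half of M times its transpose, so it vanishes with its momentum derivatives at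
  zero momentum.\<close>

lemma kolmogorov_normal_form_transformation:
  "kolmogorov_normal_form \<omega> (formal_pullback (hamiltonian \<omega> (eval f)) (transformation h M))"
proof -
  define N where "N i j = cst (1 / 2) * (\<Sum>a\<in>UNIV. M i a * M j a)" for i j
  define R where "R s z = (\<Sum>i\<in>UNIV. \<Sum>j\<in>UNIV. (fst z $ i * fst z $ j) * eval (fps_nth (N i j) s) (snd z))"
    for s and z :: "'n phase"
  obtain E where E: "\<And>p. (\<Sum>a\<in>UNIV. cst (\<omega> $ a) * momentum h M p a)
      + cst (1 / 2) * (\<Sum>a\<in>UNIV. momentum h M p a * momentum h M p a) + fps_X * formal_compose h f
    = embed E + cst (\<Sum>i\<in>UNIV. \<omega> $ i * p i) + (\<Sum>i\<in>UNIV. \<Sum>j\<in>UNIV. cst (p i * p j) * N i j)"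
    using energy_normal_form [OF h0 lindstedt left_inverse] unfolding N_def by blast
  show ?thesis
    unfolding kolmogorov_normal_form_def
  proof (intro exI conjI allI)
    fix s p q
    show "poly_trig_polynomial (R s)"
      unfolding R_def
      by (intro poly_trig_polynomial_sum poly_trig_polynomial_eval_mult real_polynomial_function.intros(4)
          real_polynomial_function_nth finite)
    show "vanishes_to_second_order (R s)"
    proof -
      note bounded_linear.has_derivative [OF bounded_linear_vec_nth, derivative_intros]
      have "((\<lambda>p. R s (p, q)) has_derivative (\<lambda>_. 0)) (at 0)" for q
        unfolding R_def by (auto intro!: derivative_eq_intros)
      then show ?thesis by (simp add: vanishes_to_second_order_def R_def)
    qed
    show "formal_pullback (hamiltonian \<omega> (eval f)) (transformation h M) s (p, q)
        = fps_nth E s + (if s = 0 then \<omega> \<bullet> p else 0) + R s (p, q)"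
      unfolding formal_pullback_hamiltonian E
      by (simp add: R_def fps_sum_nth inner_vec_def)
  qed
qed

end

lemma kolmogorov_transformation_exists:
  "\<exists>\<Phi>. formal_transformation \<Phi> \<and> canonical_transformation \<Phi> \<and>
        kolmogorov_normal_form \<omega> (formal_pullback (hamiltonian \<omega> (eval f)) \<Phi>)"
proof -
  obtain h where h: "\<And>a :: 'n. fps_nth (h a) 0 = 0"
    "\<And>a. Flow (Flow (h a)) =
      - (fps_X * (formal_compose h (trig_pd a f) - embed (Avg (formal_compose h (trig_pd a f)))))"
    using lindstedt_series_exists [of f] by blast
  obtain M where M: "\<And>i j. (\<Sum>a\<in>UNIV. M i a * jacobian h a j) = (if i = j then 1 else 0)"
    "\<And>i a. fps_nth (M i a) 0 = (if i = a then 1 else 0)"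
    using jacobian_left_inverse_exists [of h, OF h(1)] by blast
  show ?thesis
    using formal_transformation_transformation [OF h M]
      canonical_transformation_transformation [OF h M]
      kolmogorov_normal_form_transformation [OF h M] by blast
qed

end

theorem theorem8p1:
  fixes \<omega> :: "real ^ 'n::finite" and f :: "real ^ 'n \<Rightarrow> real"
  assumes "diophantine \<omega>"
    and "trig_polynomial f"
  shows "\<exists>\<Phi> :: nat \<Rightarrow> 'n phase \<Rightarrow> 'n phase.
           formal_transformation \<Phi> \<and> canonical_transformation \<Phi> \<and>
           kolmogorov_normal_form \<omega> (formal_pullback (hamiltonian \<omega> f) \<Phi>)"
proof -
  interpret nonresonant_frequency \<omega>
    by standard (rule diophantine_imp_nonresonant [OF assms(1)])
  show ?thesis
    using kolmogorov_transformation_exists [of "Trig_poly f"] assms(2)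
    by (simp add: Trig_poly_inverse)
qed

end
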